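(* Let $0<\gamma<n$, $1<p<q<\infty$ and $\mu\in\Delta_2$. Given a pair of weights $(w,\nu)$ on $\mathbb R^n$, assume that for some $r>1$ there is a constant $C<\infty$ such that for all cubes $Q$ in $\mathbb R^n$, $$|Q|^{\gamma/n+1/q-1/p}\cdot\bigg(\frac{1}{|Q|}\int_Q w(x)^r\,dx\bigg)^{1/(rq)}\bigg(\frac{1}{|Q|}\int_Q \nu(x)^{-p'/p}\,dx\bigg)^{1/p'}\leq C.$$ If $p\leq\alpha<\beta<s\leq\infty$ and $w\in\Delta_2$, then the fractional integral operator $I_\gamma$ is bounded from $(L^p,L^s)^{\alpha}(\nu,w;\mu)$ into $(WL^q,L^s)^{\beta}(w;\mu)$, where $1/\beta=1/\alpha-(1/p-1/q)$.
   Context: A weight on $\mathbb R^n$ is a nonnegative locally integrable function; for a weight $w$ and a measurable set $E$, $w(E)=\int_E w(x)\,dx$, and $|E|$ is Lebesgue measure. $p'=p/(p-1)$. All cubes have sides parallel to the coordinate axes; $Q(y,\ell)$ is the cube centered at $y$ with side length $\ell>0$, and for $\lambda>0$, $\lambda Q(y,\ell):=Q(y,\lambda\sqrt n\,\ell)$. $w\in\Delta_2$ means: $w$ is a weight and there is a finite constant $C>0$ with $w(2Q)\le C\,w(Q)$ for every cube $Q$. Fractional integral operator: for $0<\gamma<n$, $$I_\gamma f(x)=\frac1{\zeta(\gamma)}\int_{\mathbb R^n}\frac{f(y)}{|x-y|^{n-\gamma}}\,dy,\qquad \zeta(\gamma)=\frac{\pi^{n/2}2^\gamma\Gamma(\gamma/2)}{\Gamma((n-\gamma)/2)}.$$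 $\|f\|_{L^p(w)}=(\int_{\mathbb R^n}|f|^pw\,dx)^{1/p}$ and $\|f\|_{WL^p(w)}=\sup_{\lambda>0}\lambda\cdot w(\{x\in\mathbb R^n:|f(x)|>\lambda\})^{1/p}$. Weighted amalgam space: for $1\le p\le\alpha\le s\le\infty$ and weights $\nu,w,\mu$, $(L^p,L^s)^\alpha(\nu,w;\mu)$ is the space of locally integrable $f$ with $$\|f\|_{(L^p,L^s)^\alpha(\nu,w;\mu)}:=\sup_{\ell>0}\Big\|w(Q(y,\ell))^{1/\alpha-1/p-1/s}\|f\cdot\chi_{Q(y,\ell)}\|_{L^p(\nu)}\Big\|_{L^s(\mu)}<\infty,$$ where the $L^s(\mu)$-norm is taken in the variable $y$, i.e. $\|g\|_{L^s(\mu)}=(\int_{\mathbb R^n}|g(y)|^s\mu(y)\,dy)^{1/s}$, with the usual modification when $s=\infty$. Weighted weak amalgam space: for $1\le p\le\alpha\le s\le\infty$ and weights $w,\mu$, $(WL^p,L^s)^\alpha(w;\mu)$ is the space of measurable $f$ with $$\|f\|_{(WL^p,L^s)^\alpha(w;\mu)}:=\sup_{\ell>0}\Big\|w(Q(y,\ell))^{1/\alpha-1/p-1/s}\|f\cdot\chi_{Q(y,\ell)}\|_{WL^p(w)}\Big\|_{L^s(\mu)}<\infty,$$ with the usual modification when $s=\infty$. An operator $T$ is bounded from $X$ into $Y$ if there is a constant $C$ with $\|Tf\|_Y\le C\|f\|_X$ for all $f\in X$. *)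

theory Defs
  imports "HOL-Probability.Essential_Supremum"
begin

text \<open>Powers of extended nonnegative reals with \<open>0\<close> to a negative power equal to \<open>\<infinity>\<close>, \<open>\<infinity>\<close> to a
  negative power equal to \<open>0\<close>, and every zeroth power equal to \<open>1\<close>.  The real \<open>powr\<close> would give
  \<open>0 powr a = 0\<close> also for negative \<open>a\<close>, so that zeros of \<open>\<nu>\<close> would be invisible in the integral
  of \<open>\<nu>\<close> to the power \<open>-p'/p\<close>.\<close>

definition epowr :: "ennreal \<Rightarrow> real \<Rightarrow> ennreal" where
  "epowr x a =
    (if a = 0 then 1
     else if x = 0 then (if a < 0 then \<infinity> else 0)
     else if x = \<infinity> then (if a < 0 then 0 else \<infinity>)
     else ennreal (enn2real x powr a))"

definition conj_exp :: "real \<Rightarrow> real" where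
  "conj_exp p = p / (p - 1)"

definition cube :: "real ^ 'n \<Rightarrow> real \<Rightarrow> (real ^ 'n) set" where
  "cube y l = {x. \<forall>i. \<bar>x $ i - y $ i\<bar> \<le> l / 2}"

text \<open>The dilate \<open>\<lambda>Q(y, l)\<close>; the factor \<open>\<surd>n\<close> is part of the convention used here.\<close>

definition dilated_cube :: "real \<Rightarrow> real ^ 'n \<Rightarrow> real \<Rightarrow> (real ^ 'n) set" where
  "dilated_cube t y l = cube y (t * sqrt (real CARD('n)) * l)"

definition locally_integrable :: "(real ^ 'n \<Rightarrow> 'b::{banach, second_countable_topology}) \<Rightarrow> bool" where
  "locally_integrable f \<longleftrightarrow> (\<forall>K. compact K \<longrightarrow> f absolutely_integrable_on K)"

definition weight :: "(real ^ 'n \<Rightarrow> real) \<Rightarrow> bool" where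
  "weight w \<longleftrightarrow> (\<forall>x. 0 \<le> w x) \<and> locally_integrable w"

definition wmeas :: "(real ^ 'n \<Rightarrow> real) \<Rightarrow> (real ^ 'n) set \<Rightarrow> ennreal" where
  "wmeas w E = (\<integral>\<^sup>+x\<in>E. ennreal (w x) \<partial>lebesgue)"

definition Delta2 :: "(real ^ 'n \<Rightarrow> real) set" where
  "Delta2 = {w. weight w \<and>
     (\<exists>C::real. C > 0 \<and> (\<forall>y l. l > 0 \<longrightarrow> wmeas w (dilated_cube 2 y l) \<le> ennreal C * wmeas w (cube y l)))}"

definition cube_avg :: "(real ^ 'n \<Rightarrow> ennreal) \<Rightarrow> (real ^ 'n) set \<Rightarrow> ennreal" where
  "cube_avg g Q = (\<integral>\<^sup>+x\<in>Q. g x \<partial>lebesgue) / emeasure lebesgue Q"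

definition zeta_const :: "nat \<Rightarrow> real \<Rightarrow> real" where
  "zeta_const n \<gamma> = pi powr (real n / 2) * 2 powr \<gamma> * Gamma (\<gamma> / 2) / Gamma ((real n - \<gamma>) / 2)"

definition riesz_integrand :: "real \<Rightarrow> (real ^ 'n \<Rightarrow> complex) \<Rightarrow> real ^ 'n \<Rightarrow> real ^ 'n \<Rightarrow> complex" where
  "riesz_integrand \<gamma> f x y = f y /\<^sub>R (norm (x - y) powr (real CARD('n) - \<gamma>))"

text \<open>As a Bochner integral this is \<open>0\<close> at those \<open>x\<close> where the integral does not converge
  absolutely.\<close>

definition frac_integral :: "real \<Rightarrow> (real ^ 'n \<Rightarrow> complex) \<Rightarrow> real ^ 'n \<Rightarrow> complex" where
  "frac_integral \<gamma> f x = (\<integral>y. riesz_integrand \<gamma> f x y \<partial>lebesgue) /\<^sub>R zeta_const CARD('n) \<gamma>"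

definition Lp_norm :: "real \<Rightarrow> (real ^ 'n \<Rightarrow> real) \<Rightarrow> (real ^ 'n \<Rightarrow> complex) \<Rightarrow> ennreal" where
  "Lp_norm p w f = epowr (\<integral>\<^sup>+x. ennreal (norm (f x) powr p * w x) \<partial>lebesgue) (1 / p)"

definition WLp_norm :: "real \<Rightarrow> (real ^ 'n \<Rightarrow> real) \<Rightarrow> (real ^ 'n \<Rightarrow> complex) \<Rightarrow> ennreal" where
  "WLp_norm p w f = (SUP t\<in>{0<..}. ennreal t * epowr (wmeas w {x. norm (f x) > t}) (1 / p))"

text \<open>The outer norm, for \<open>0 < s \<le> \<infinity>\<close>, of a function with values in \<open>[0, \<infinity>]\<close>.\<close>

definition Ls_norm :: "ennreal \<Rightarrow> (real ^ 'n \<Rightarrow> real) \<Rightarrow> (real ^ 'n \<Rightarrow> ennreal) \<Rightarrow> ennreal" where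
  "Ls_norm s \<mu> g =
    (if s = \<infinity> then esssup (density lebesgue (\<lambda>y. ennreal (\<mu> y))) g
     else epowr (\<integral>\<^sup>+y. epowr (g y) (enn2real s) * ennreal (\<mu> y) \<partial>lebesgue) (1 / enn2real s))"

definition restrict_to :: "(real ^ 'n) set \<Rightarrow> (real ^ 'n \<Rightarrow> complex) \<Rightarrow> real ^ 'n \<Rightarrow> complex" where
  "restrict_to Q f x = indicator Q x *\<^sub>R f x"

text \<open>In the exponents below, \<open>enn2real (1 / s)\<close> is \<open>1 / s\<close>, equal to \<open>0\<close> for \<open>s = \<infinity>\<close>.\<close>

definition amalgam_norm :: "real \<Rightarrow> ennreal \<Rightarrow> real \<Rightarrow> (real ^ 'n \<Rightarrow> real) \<Rightarrow> (real ^ 'n \<Rightarrow> real) \<Rightarrow>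
    (real ^ 'n \<Rightarrow> real) \<Rightarrow> (real ^ 'n \<Rightarrow> complex) \<Rightarrow> ennreal" where
  "amalgam_norm p s \<alpha> \<nu> w \<mu> f =
    (SUP l\<in>{0<..}. Ls_norm s \<mu> (\<lambda>y.
       epowr (wmeas w (cube y l)) (1 / \<alpha> - 1 / p - enn2real (1 / s)) *
       Lp_norm p \<nu> (restrict_to (cube y l) f)))"

definition amalgam_space :: "real \<Rightarrow> ennreal \<Rightarrow> real \<Rightarrow> (real ^ 'n \<Rightarrow> real) \<Rightarrow> (real ^ 'n \<Rightarrow> real) \<Rightarrow>
    (real ^ 'n \<Rightarrow> real) \<Rightarrow> (real ^ 'n \<Rightarrow> complex) set" where
  "amalgam_space p s \<alpha> \<nu> w \<mu> = {f. locally_integrable f \<and> amalgam_norm p s \<alpha> \<nu> w \<mu> f < \<infinity>}"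

definition weak_amalgam_norm :: "real \<Rightarrow> ennreal \<Rightarrow> real \<Rightarrow> (real ^ 'n \<Rightarrow> real) \<Rightarrow>
    (real ^ 'n \<Rightarrow> real) \<Rightarrow> (real ^ 'n \<Rightarrow> complex) \<Rightarrow> ennreal" where
  "weak_amalgam_norm p s \<alpha> w \<mu> f =
    (SUP l\<in>{0<..}. Ls_norm s \<mu> (\<lambda>y.
       epowr (wmeas w (cube y l)) (1 / \<alpha> - 1 / p - enn2real (1 / s)) *
       WLp_norm p w (restrict_to (cube y l) f)))"

definition weak_amalgam_space :: "real \<Rightarrow> ennreal \<Rightarrow> real \<Rightarrow> (real ^ 'n \<Rightarrow> real) \<Rightarrow>
    (real ^ 'n \<Rightarrow> real) \<Rightarrow> (real ^ 'n \<Rightarrow> complex) set" where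
  "weak_amalgam_space p s \<alpha> w \<mu> =
    {f. f \<in> borel_measurable lebesgue \<and> weak_amalgam_norm p s \<alpha> w \<mu> f < \<infinity>}"

definition bounded_operator :: "('a \<Rightarrow> 'b) \<Rightarrow> 'a set \<Rightarrow> ('a \<Rightarrow> ennreal) \<Rightarrow> 'b set \<Rightarrow> ('b \<Rightarrow> ennreal) \<Rightarrow> bool" where
  "bounded_operator T X NX Y NY \<longleftrightarrow>
    (\<forall>f\<in>X. T f \<in> Y) \<and> (\<exists>C::real. \<forall>f\<in>X. NY (T f) \<le> ennreal C * NX f)"

end

theory Submission
  imports Defs
begin

text \<open>
  If \<open>w\<close> vanishes almost everywhere, every weak norm on the target side is \<open>0\<close>. Otherwise local
  integrability and doubling give \<open>0 < w(Q) < \<infinity>\<close> for all cubes, and reverse doubling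
  \<open>w(Q(y, l)) \<le> \<rho> w(Q(y, 2l))\<close> with \<open>\<rho> < 1\<close> (\<open>reverse_doubling\<close>).

  By Hoelder's inequality (\<open>frac_avg_le_of_bump\<close>) the bump condition bounds the fractional average
  \<open>a(x, l)\<close>, that is \<open>l\<close> to the power \<open>\<gamma> - n\<close> times the integral of \<open>\<bar>f\<bar>\<close> over \<open>Q(x, l)\<close>, by a constant
  times \<open>w(Q)\<close> to the power \<open>-1/q\<close> times the \<open>1/p\<close>-th power of the integral of \<open>F = \<bar>f\<bar>\<^sup>p \<nu>\<close> over
  \<open>Q = Q(x, l)\<close>. The fractional integral of \<open>\<bar>f\<bar>\<close> at \<open>x\<close> is at most a constant times the sum of
  \<open>a(x, l 2\<^sup>k)\<close> over all integers \<open>k\<close>, for any \<open>l > 0\<close> (\<open>riesz_kernel_le\<close>). Fix a cube \<open>Q(y, l)\<close>, let \<open>x\<close>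
  range over it and split the sum at \<open>k = 0\<close>.

  The small cubes are treated as in Hedberg's proof of the Hardy-Littlewood-Sobolev inequality, with
  \<open>w(Q)\<close> in place of the side length. They lie in \<open>Q(y, 2l)\<close>; let \<open>T\<close> be the integral of \<open>F\<close> over this cube.
  If the integral of \<open>F\<close> over each small cube is at most \<open>\<tau> w(Q)\<close>, then the fractional averages are at most
  a constant times the minimum of \<open>T\<^sup>1\<^sup>/\<^sup>p w(Q)\<^sup>-\<^sup>1\<^sup>/\<^sup>q\<close> and \<open>\<tau>\<^sup>1\<^sup>/\<^sup>p w(Q)\<^sup>\<epsilon>\<close>, with
  \<open>\<epsilon> = 1/p - 1/q > 0\<close>. By reverse doubling these minima form a two-sided geometric series, whose
  sum is at most a constant times \<open>T\<^sup>\<epsilon> \<tau>\<^sup>1\<^sup>/\<^sup>q\<close> (\<open>near_sum_le_Hedberg\<close>). Hence where the sum exceeds \<open>t\<close>, the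
  centred maximal function of \<open>F\<close> with respect to \<open>w\<close> exceeds a threshold, and its weak type (1,1)
  bound, a consequence of Vitali's covering lemma and doubling (\<open>weak_type_maximal\<close>), yields the weak type
  \<open>(p, q)\<close> bound by the \<open>L\<^sup>p(\<nu>)\<close> norm of \<open>f\<close> on \<open>Q(y, 2l)\<close> (\<open>near_sum_weak_type\<close>).

  The large cubes are bounded uniformly in \<open>x\<close> by fractional averages over concentric cubes
  \<open>Q(y, l 2\<^sup>j)\<close>. After multiplication by the power \<open>\<eta> = 1/\<beta> - 1/s > 0\<close> of \<open>w(Q(y, l))\<close>, reverse
  doubling produces the factor \<open>\<rho>\<^sup>j\<^sup>\<eta>\<close> (\<open>far_bound_le\<close>). Together, the function of \<open>y\<close>
  whose outer norm is the weak amalgam norm at scale \<open>l\<close> is at most a geometric series of the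
  corresponding functions for the amalgam norm of \<open>f\<close> at the scales \<open>l 2\<^sup>j\<close>
  (\<open>weak_norm_le_series\<close>), and the outer norms are summed by Jensen's inequality
  (\<open>Ls_norm_series_le\<close>).

  For the convergence of the integral, the large cubes contribute a finite amount for a suitable
  centre \<open>y\<close> with \<open>\<mu>(y) > 0\<close>, and the small cubes contribute a finite amount at almost every \<open>x\<close> by
  Tonelli's theorem and the local integrability of \<open>f\<close> (\<open>near_sum_AE_finite\<close>).
\<close>

section \<open>Powers of extended nonnegative reals and Hoelder's inequality\<close>

lemma epowr_ennreal: "0 < x \<Longrightarrow> epowr (ennreal x) a = ennreal (x powr a)"
  by (auto simp: epowr_def)

lemma epowr_ennreal_nonneg: "0 \<le> x \<Longrightarrow> 0 < a \<Longrightarrow> epowr (ennreal x) a = ennreal (x powr a)"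
  by (cases "x = 0") (auto simp: epowr_def)

lemma epowr_top: "0 < a \<Longrightarrow> epowr \<infinity> a = \<infinity>"
  by (simp add: epowr_def)

lemma epowr_0: "0 < a \<Longrightarrow> epowr 0 a = 0"
  by (simp add: epowr_def)

lemma epowr_one: "epowr x 1 = x"
  by (cases x) (auto simp: epowr_def)

lemma epowr_eq_0_iff: "0 < a \<Longrightarrow> epowr x a = 0 \<longleftrightarrow> x = 0"
  by (cases x) (auto simp: epowr_def)

lemma epowr_eq_top_iff: "0 < a \<Longrightarrow> epowr x a = \<infinity> \<longleftrightarrow> x = \<infinity>"
  by (cases x) (auto simp: epowr_def)

lemma epowr_mono: "x \<le> y \<Longrightarrow> 0 < a \<Longrightarrow> epowr x a \<le> epowr y a"
  by (cases x; cases y) (auto simp: epowr_ennreal_nonneg epowr_top[unfolded infinity_ennreal_def]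
      top_unique intro!: ennreal_leI powr_mono2)

lemma epowr_mult: "0 < a \<Longrightarrow> epowr (x * y) a = epowr x a * epowr y a"
proof (cases x; cases y)
  fix u v assume "0 < a" "0 \<le> u" "x = ennreal u" "0 \<le> v" "y = ennreal v"
  then show ?thesis
    by (simp add: epowr_ennreal_nonneg powr_mult flip: ennreal_mult)
next
  fix u assume "0 < a" "0 \<le> u" "x = ennreal u" "y = top"
  then show ?thesis
    by (cases "u = 0") (auto simp: epowr_ennreal epowr_0 ennreal_mult_top epowr_top[unfolded infinity_ennreal_def])
next
  fix u assume "0 < a" "0 \<le> u" "y = ennreal u" "x = top"
  then show ?thesis
    by (cases "u = 0") (auto simp: epowr_ennreal epowr_0 ennreal_top_mult epowr_top[unfolded infinity_ennreal_def])
next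
  assume "0 < a" "x = top" "y = top"
  then show ?thesis
    by (simp add: epowr_top[unfolded infinity_ennreal_def])
qed

lemma epowr_epowr: "0 < a \<Longrightarrow> 0 < b \<Longrightarrow> epowr (epowr x a) b = epowr x (a * b)"
  by (cases x) (auto simp: epowr_ennreal_nonneg epowr_top[unfolded infinity_ennreal_def] powr_powr)

lemma measurable_epowr [measurable (raw)]:
  assumes [measurable]: "f \<in> borel_measurable M"
  shows "(\<lambda>x. epowr (f x) a) \<in> borel_measurable M"
proof -
  have "(\<lambda>x. epowr x a) = (\<lambda>x. if a = 0 then 1 else if x = 0 then (if a < 0 then \<infinity> else 0)
     else if x = \<infinity> then (if a < 0 then 0 else \<infinity>) else ennreal (enn2real x powr a))"
    by (simp add: epowr_def fun_eq_iff)
  moreover have "\<dots> \<in> borel_measurable borel"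
    by measurable
  ultimately have "(\<lambda>x. epowr x a) \<in> borel_measurable borel"
    by simp
  from measurable_compose[OF assms this] show ?thesis .
qed

lemma nn_integral_Holder:
  fixes f g :: "'a \<Rightarrow> ennreal"
  assumes f[measurable]: "f \<in> borel_measurable M" and g[measurable]: "g \<in> borel_measurable M"
    and pq: "1 < p" "1 < q" "1 / p + 1 / q = (1::real)"
  shows "(\<integral>\<^sup>+x. f x * g x \<partial>M) \<le>
    epowr (\<integral>\<^sup>+x. epowr (f x) p \<partial>M) (1 / p) * epowr (\<integral>\<^sup>+x. epowr (g x) q \<partial>M) (1 / q)"
proof -
  define A where "A = (\<integral>\<^sup>+x. epowr (f x) p \<partial>M)"
  define B where "B = (\<integral>\<^sup>+x. epowr (g x) q \<partial>M)"
  have pos: "0 < p" "0 < q" "0 < 1 / p" "0 < 1 / q" using pq by auto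
  consider "A = 0" | "B = 0" | "A \<noteq> 0" "B = \<infinity>" | "A = \<infinity>" "B \<noteq> 0"
    | a b where "0 < a" "A = ennreal a" "0 < b" "B = ennreal b"
    by (cases A; cases B) (auto simp: less_le)
  then have "(\<integral>\<^sup>+x. f x * g x \<partial>M) \<le> epowr A (1 / p) * epowr B (1 / q)"
  proof cases
    case 1
    then have "AE x in M. epowr (f x) p = 0"
      unfolding A_def by (subst (asm) nn_integral_0_iff_AE) auto
    then have "AE x in M. f x * g x = 0"
      by eventually_elim (use pos in \<open>auto simp: epowr_eq_0_iff\<close>)
    then have "(\<integral>\<^sup>+x. f x * g x \<partial>M) = 0"
      by (subst nn_integral_0_iff_AE) auto
    then show ?thesis by simp
  next
    case 2
    then have "AE x in M. epowr (g x) q = 0"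
      unfolding B_def by (subst (asm) nn_integral_0_iff_AE) auto
    then have "AE x in M. f x * g x = 0"
      by eventually_elim (use pos in \<open>auto simp: epowr_eq_0_iff\<close>)
    then have "(\<integral>\<^sup>+x. f x * g x \<partial>M) = 0"
      by (subst nn_integral_0_iff_AE) auto
    then show ?thesis by simp
  next
    case 3
    then show ?thesis using pos epowr_eq_0_iff[of "1/p" A]
      by (simp add: epowr_top[OF pos(4), unfolded infinity_ennreal_def] ennreal_mult_top)
  next
    case 4
    then show ?thesis using pos epowr_eq_0_iff[of "1/q" B]
      by (simp add: epowr_top[OF pos(3), unfolded infinity_ennreal_def] ennreal_top_mult)
  next
    case (5 a b)
    define c where "c = a powr (1 / p)"
    define d where "d = b powr (1 / q)"
    have cd: "0 < c" "0 < d" "c powr p = a" "d powr q = b"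
      using 5 pos by (auto simp: c_def d_def powr_powr)
    have le: "f x * g x \<le> ennreal (c * d / (p * a)) * epowr (f x) p
        + ennreal (c * d / (q * b)) * epowr (g x) q" for x
    proof (cases "f x = \<infinity> \<or> g x = \<infinity>")
      case True
      then show ?thesis
        using 5 cd pos by (auto simp: epowr_top[unfolded infinity_ennreal_def] ennreal_mult_top)
    next
      case False
      then obtain u v where uv: "0 \<le> u" "f x = ennreal u" "0 \<le> v" "g x = ennreal v"
        by (cases "f x"; cases "g x") auto
      have "(u / c) * (v / d) \<le> (u / c) powr p / p + (v / d) powr q / q"
        using pq uv cd by (intro Youngs_inequality) auto
      also have "\<dots> = u powr p / (p * a) + v powr q / (q * b)"
        using uv cd by (simp add: powr_divide mult.commute)
      finally have "c * d * ((u / c) * (v / d)) \<le> c * d * (u powr p / (p * a) + v powr q / (q * b))"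
        using cd by (intro mult_left_mono) auto
      then have "u * v \<le> c * d / (p * a) * u powr p + c * d / (q * b) * v powr q"
        using cd by (simp add: field_simps)
      then show ?thesis
        using uv pos cd 5 by (simp add: epowr_ennreal_nonneg flip: ennreal_mult ennreal_plus)
    qed
    have "(\<integral>\<^sup>+x. f x * g x \<partial>M) \<le> (\<integral>\<^sup>+x. ennreal (c * d / (p * a)) * epowr (f x) p
        + ennreal (c * d / (q * b)) * epowr (g x) q \<partial>M)"
      by (intro nn_integral_mono le)
    also have "\<dots> = ennreal (c * d / (p * a)) * A + ennreal (c * d / (q * b)) * B"
      unfolding A_def B_def by (subst nn_integral_add) (auto simp: nn_integral_cmult)
    also have "\<dots> = ennreal (c * d * (1 / p + 1 / q))"
      using 5 pos cd by (simp add: field_simps flip: ennreal_mult ennreal_plus)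
    also have "\<dots> = epowr A (1 / p) * epowr B (1 / q)"
      unfolding pq using 5 by (simp add: epowr_ennreal c_def d_def flip: ennreal_mult)
    finally show ?thesis .
  qed
  then show ?thesis unfolding A_def B_def .
qed

section \<open>Cubes\<close>

lemma cube_eq_cbox: "cube (y :: real ^ 'n) l = cbox (\<chi> i. y $ i - l / 2) (\<chi> i. y $ i + l / 2)"
proof -
  have "\<bar>x $ i - y $ i\<bar> \<le> l / 2 \<longleftrightarrow> y $ i - l / 2 \<le> x $ i \<and> x $ i \<le> y $ i + l / 2" for x :: "real ^ 'n" and i
    by linarith
  then show ?thesis unfolding set_eq_iff cube_def mem_box_cart mem_Collect_eq by simp
qed

lemma compact_cube: "compact (cube y l)"
  by (simp add: cube_eq_cbox)

lemma cube_sets [measurable]: "cube y l \<in> sets borel" "cube y l \<in> sets lebesgue"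
  by (auto simp: cube_eq_cbox)

lemma emeasure_cube:
  fixes y :: "real ^ 'n"
  assumes "0 < l"
  shows "emeasure lebesgue (cube y l) = ennreal (l powr real CARD('n))"
proof -
  have "cube y l \<noteq> {}" using assms by (auto simp: cube_def intro!: exI[of _ y])
  then have "measure lborel (cube y l) = (\<Prod>i\<in>(UNIV::'n set). l)"
    unfolding cube_eq_cbox by (subst content_cbox_cart) auto
  also have "\<dots> = l powr real CARD('n)"
    using assms by (simp add: powr_realpow)
  finally have "measure lebesgue (cube y l) = l powr real CARD('n)"
    by (simp add: measure_completion)
  moreover have "cube y l \<in> lmeasurable"
    by (simp add: cube_eq_cbox)
  ultimately show ?thesis
    by (simp add: emeasure_eq_measure2)
qed

lemma mem_cube_commute: "x \<in> cube y l \<longleftrightarrow> y \<in> cube x l"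
  by (simp add: cube_def abs_minus_commute)

lemma mem_cube_self: "0 \<le> l \<Longrightarrow> y \<in> cube y l"
  by (simp add: cube_def)

lemma cube_mono: "l \<le> m \<Longrightarrow> cube y l \<subseteq> cube y m"
  unfolding cube_def by (auto intro: order_trans[of _ l])

lemma cube_subset: assumes "x \<in> cube y l" "l + m \<le> k" shows "cube x m \<subseteq> cube y k"
proof
  fix z assume z: "z \<in> cube x m"
  have "\<bar>z $ i - y $ i\<bar> \<le> k / 2" for i
  proof -
    have "\<bar>z $ i - x $ i\<bar> \<le> m / 2" "\<bar>x $ i - y $ i\<bar> \<le> l / 2"
      using assms(1) z by (auto simp: cube_def)
    then show ?thesis using assms(2) by linarith
  qed
  then show "z \<in> cube y k" by (simp add: cube_def)
qed

lemma measurable_indicator_cube [measurable]: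
  "(\<lambda>z. indicator (cube (fst z) l) (snd z) :: ennreal) \<in> borel_measurable (borel \<Otimes>\<^sub>M borel)"
proof -
  have "closed {z :: (real ^ 'n) \<times> (real ^ 'n). \<forall>i. \<bar>snd z $ i - fst z $ i\<bar> \<le> l / 2}"
    by (intro closed_Collect_all closed_Collect_le continuous_intros)
  then have "{z :: (real ^ 'n) \<times> (real ^ 'n). \<forall>i. \<bar>snd z $ i - fst z $ i\<bar> \<le> l / 2}
      \<in> sets (borel \<Otimes>\<^sub>M borel)"
    unfolding borel_prod by (rule borel_closed)
  then have "(indicator {z :: (real ^ 'n) \<times> (real ^ 'n). \<forall>i. \<bar>snd z $ i - fst z $ i\<bar> \<le> l / 2} :: _ \<Rightarrow> ennreal)
      \<in> borel_measurable (borel \<Otimes>\<^sub>M borel)"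
    by (rule borel_measurable_indicator)
  then show ?thesis
    by (rule back_subst[of "\<lambda>g. g \<in> borel_measurable (borel \<Otimes>\<^sub>M borel)"])
       (auto simp: indicator_def cube_def fun_eq_iff)
qed

lemma nn_integral_lebesgue: "nn_integral lebesgue f = nn_integral lborel f"
  by (rule nn_integral_completion)

text \<open>Fubini-type measurability in the centre; the Lebesgue measurable integrand is replaced by a
  Borel function that agrees with it almost everywhere, as Lebesgue measure on the product is not
  the product of the Lebesgue measures.\<close>

lemma measurable_cube_integral:
  fixes F :: "real ^ 'n \<Rightarrow> ennreal"
  assumes "F \<in> borel_measurable lebesgue"
  shows "(\<lambda>y. \<integral>\<^sup>+x\<in>cube y l. F x \<partial>lebesgue) \<in> borel_measurable borel"
proof -
  obtain G where G[measurable]: "G \<in> borel_measurable borel" and eq: "AE x in lborel. F x = G x"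
    using completion_ex_borel_measurable[OF assms] by auto
  have "(\<integral>\<^sup>+x\<in>cube y l. F x \<partial>lebesgue) = (\<integral>\<^sup>+x. G x * indicator (cube y l) x \<partial>lborel)" for y
    unfolding nn_integral_lebesgue by (intro nn_integral_cong_AE) (use eq in \<open>eventually_elim, simp\<close>)
  moreover have "(\<lambda>y. \<integral>\<^sup>+x. G x * indicator (cube y l) x \<partial>lborel) \<in> borel_measurable borel"
    by (rule lborel.borel_measurable_nn_integral)
       (use measurable_indicator_cube[of l] in \<open>simp add: case_prod_beta, measurable\<close>)
  ultimately show ?thesis by simp
qed

section \<open>Doubling weights\<close>

lemma locally_integrable_measurable:
  fixes f :: "real ^ 'n \<Rightarrow> 'b::{banach, second_countable_topology}"
  assumes "locally_integrable f"
  shows "f \<in> borel_measurable lebesgue"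
proof (rule borel_measurable_LIMSEQ_metric)
  fix k :: nat
  have "set_integrable lebesgue (cball 0 (real k)) f"
    using assms by (auto simp: locally_integrable_def)
  then show "(\<lambda>x. indicator (cball 0 (real k)) x *\<^sub>R f x) \<in> borel_measurable lebesgue"
    unfolding set_integrable_def by (rule borel_measurable_integrable)
next
  fix x :: "real ^ 'n"
  obtain m :: nat where "norm x \<le> real m" using real_arch_simple by blast
  then have "eventually (\<lambda>k. norm x \<le> real k) sequentially"
    by (intro eventually_sequentiallyI[of m]) auto
  then have "eventually (\<lambda>k. indicator (cball 0 (real k)) x *\<^sub>R f x = f x) sequentially"
    by eventually_elim (simp add: indicator_def)
  then show "(\<lambda>k. indicator (cball 0 (real k)) x *\<^sub>R f x) \<longlonglongrightarrow> f x"
    by (rule tendsto_eventually)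
qed

lemma locally_integrable_nn_integral_cube:
  fixes f :: "real ^ 'n \<Rightarrow> 'b::{banach, second_countable_topology}"
  assumes "locally_integrable f"
  shows "(\<integral>\<^sup>+x\<in>cube y l. ennreal (norm (f x)) \<partial>lebesgue) < \<infinity>"
proof -
  have "set_integrable lebesgue (cube y l) f"
    using assms compact_cube by (auto simp: locally_integrable_def)
  then have "(\<integral>\<^sup>+x. ennreal (norm (indicator (cube y l) x *\<^sub>R f x)) \<partial>lebesgue) < \<infinity>"
    unfolding set_integrable_def integrable_iff_bounded by simp
  also have "(\<integral>\<^sup>+x. ennreal (norm (indicator (cube y l) x *\<^sub>R f x)) \<partial>lebesgue)
      = (\<integral>\<^sup>+x\<in>cube y l. ennreal (norm (f x)) \<partial>lebesgue)"
    by (intro nn_integral_cong) (auto simp: indicator_def)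
  finally show ?thesis .
qed

lemma weight_measurable: "weight w \<Longrightarrow> w \<in> borel_measurable lebesgue"
  by (simp add: weight_def locally_integrable_measurable)

lemma wmeas_cube_finite: "weight w \<Longrightarrow> wmeas w (cube y l) < \<infinity>"
  using locally_integrable_nn_integral_cube[of w y l] by (simp add: wmeas_def weight_def)

lemma wmeas_mono: "A \<subseteq> B \<Longrightarrow> wmeas w A \<le> wmeas w B"
  unfolding wmeas_def by (intro nn_integral_mono) (auto simp: indicator_def)

lemma wmeas_eq_emeasure:
  assumes "weight w" "A \<in> sets lebesgue"
  shows "wmeas w A = emeasure (density lebesgue (\<lambda>x. ennreal (w x))) A"
  using assms weight_measurable[of w] by (simp add: wmeas_def emeasure_density)

lemma cube_subset_cball:
  fixes x :: "real ^ 'n"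
  assumes "0 \<le> l"
  shows "cube x l \<subseteq> cball x (sqrt (real CARD('n)) * l / 2)"
proof
  fix z assume "z \<in> cube x l"
  then have "\<bar>(z - x) $ i\<bar> \<le> l / 2" for i by (simp add: cube_def)
  then have "((z - x) $ i)\<^sup>2 \<le> (l / 2)\<^sup>2" for i
    by (metis abs_ge_zero power2_abs power_mono)
  then have "(\<Sum>i\<in>UNIV. ((z - x) $ i)\<^sup>2) \<le> real CARD('n) * (l / 2)\<^sup>2"
    using sum_mono[of UNIV "\<lambda>i. ((z - x) $ i)\<^sup>2" "\<lambda>i. (l / 2)\<^sup>2"] by simp
  then have "norm (z - x) \<le> sqrt (real CARD('n) * (l / 2)\<^sup>2)"
    unfolding norm_vec_def L2_set_def by simp
  then show "z \<in> cball x (sqrt (real CARD('n)) * l / 2)"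
    using assms by (simp add: real_sqrt_mult dist_norm norm_minus_commute)
qed

lemma cball_subset_cube: "cball x r \<subseteq> cube x (2 * r)"
proof
  fix z assume "z \<in> cball x r"
  then have "norm (z - x) \<le> r" by (simp add: dist_norm norm_minus_commute)
  then show "z \<in> cube x (2 * r)"
    using component_le_norm_cart[of "z - x"] by (auto simp: cube_def intro: order_trans)
qed

lemma sqrt_card_ge_1: "1 \<le> sqrt (real CARD('n::finite))"
  using one_le_card_finite[where ?'a = 'n] by simp

text \<open>A doubling weight that does not vanish almost everywhere, with its doubling constant.\<close>

locale doubling_weight =
  fixes w :: "real ^ 'n \<Rightarrow> real" and D :: real
  assumes weight: "weight w"
    and D_ge_1: "1 \<le> D"
    and not_null: "\<not> (AE x in lebesgue. w x = 0)"
    and doubling: "\<And>y l. 0 < l \<Longrightarrow> wmeas w (dilated_cube 2 y l) \<le> ennreal D * wmeas w (cube y l)"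
begin

text \<open>The measure \<open>w(Q(y, l))\<close> as a real number.\<close>

definition W :: "real ^ 'n \<Rightarrow> real \<Rightarrow> real" where
  "W y l = enn2real (wmeas w (cube y l))"

lemma wmeas_eq_W: "wmeas w (cube y l) = ennreal (W y l)"
  using wmeas_cube_finite[OF weight, of y l] by (simp add: W_def)

lemma W_nonneg: "0 \<le> W y l"
  by (simp add: W_def)

lemma doubling_iterate:
  assumes "0 < l"
  shows "wmeas w (cube y ((2 * sqrt (real CARD('n))) ^ k * l)) \<le> ennreal (D ^ k) * wmeas w (cube y l)"
proof (induction k)
  case (Suc k)
  let ?s = "2 * sqrt (real CARD('n))"
  have "wmeas w (cube y (?s ^ Suc k * l)) = wmeas w (dilated_cube 2 y (?s ^ k * l))"
    by (simp add: dilated_cube_def mult_ac)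
  also have "\<dots> \<le> ennreal D * wmeas w (cube y (?s ^ k * l))"
    using assms by (intro doubling) simp
  also have "\<dots> \<le> ennreal D * (ennreal (D ^ k) * wmeas w (cube y l))"
    by (intro mult_left_mono Suc) simp
  also have "\<dots> = ennreal (D ^ Suc k) * wmeas w (cube y l)"
    using D_ge_1 by (simp add: ennreal_mult mult.assoc)
  finally show ?case .
qed simp

lemma doubling_pow2:
  assumes "0 < l" "m \<le> 2 ^ k * l"
  shows "wmeas w (cube y m) \<le> ennreal (D ^ k) * wmeas w (cube y l)"
proof -
  have "2 ^ k \<le> (2 * sqrt (real CARD('n))) ^ k"
    using sqrt_card_ge_1[where ?'n = 'n] by (intro power_mono) auto
  then have "2 ^ k * l \<le> (2 * sqrt (real CARD('n))) ^ k * l"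
    using assms(1) by (intro mult_right_mono) auto
  then have "m \<le> (2 * sqrt (real CARD('n))) ^ k * l"
    using assms(2) by linarith
  then show ?thesis
    using doubling_iterate[OF assms(1), of y k] wmeas_mono[OF cube_mono] by (meson order_trans)
qed

lemma W_doubling_pow2:
  assumes "0 < l" "m \<le> 2 ^ k * l"
  shows "W y m \<le> D ^ k * W y l"
  using doubling_pow2[OF assms, of y] D_ge_1 W_nonneg[of y l]
  unfolding wmeas_eq_W by (simp flip: ennreal_mult)

lemma W_mono: "cube x l \<subseteq> cube y m \<Longrightarrow> W x l \<le> W y m"
  using wmeas_mono[of "cube x l" "cube y m" w] W_nonneg[of y m] unfolding wmeas_eq_W by simp

lemma W_pos:
  assumes "0 < l"
  shows "0 < W y l"
proof (rule ccontr)
  assume "\<not> 0 < W y l"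
  then have 0: "wmeas w (cube y l) = 0" by (simp add: wmeas_eq_W not_less ennreal_neg)
  have "AE x in lebesgue. x \<in> cube y (2 ^ k * l) \<longrightarrow> w x = 0" for k :: nat
  proof -
    have "wmeas w (cube y (2 ^ k * l)) = 0"
      using doubling_pow2[OF assms, of "2 ^ k * l" k y] 0 by simp
    then have "AE x in lebesgue. ennreal (w x) * indicator (cube y (2 ^ k * l)) x = 0"
      unfolding wmeas_def using weight_measurable[OF weight]
      by (subst (asm) nn_integral_0_iff_AE) auto
    then show ?thesis
      by eventually_elim (use weight in \<open>auto simp: weight_def indicator_def ennreal_eq_0_iff intro: antisym\<close>)
  qed
  then have "AE x in lebesgue. \<forall>k::nat. x \<in> cube y (2 ^ k * l) \<longrightarrow> w x = 0"
    unfolding AE_all_countable by blast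
  then have "AE x in lebesgue. w x = 0"
  proof eventually_elim
    case (elim x)
    obtain k :: nat where k: "2 * dist y x / l < 2 ^ k"
      using real_arch_pow[of 2 "2 * dist y x / l"] by auto
    have "x \<in> cube y (2 * dist y x)"
      using cball_subset_cube[of y "dist y x"] by auto
    also have "\<dots> \<subseteq> cube y (2 ^ k * l)"
      using k assms by (intro cube_mono) (simp add: field_simps)
    finally show ?case using elim by blast
  qed
  with not_null show False by contradiction
qed

text \<open>The reverse doubling constant: the doubled cube contains, next to the original cube, a
  disjoint cube of comparable measure.\<close>

definition rho :: real where "rho = 1 / (1 + 1 / D ^ 4)"

lemma rho_bounds: "0 < rho" "rho < 1"
  using D_ge_1 by (auto simp: rho_def field_simps add_pos_pos)

lemma reverse_doubling:
  assumes l: "0 < l"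
  shows "W y l \<le> rho * W y (2 * l)"
proof -
  obtain i0 :: 'n where True by simp
  \<comment> \<open>The cube \<open>Q(z, l/4)\<close> lies in \<open>Q(y, 2l)\<close>, misses \<open>Q(y, l)\<close>, and its dilate by \<open>2\<^sup>4\<close> covers \<open>Q(y, l)\<close>.\<close>
  define z where "z = y + axis i0 (3 * l / 4)"
  have zi: "z $ i = y $ i + (if i = i0 then 3 * l / 4 else 0)" for i
    by (simp add: z_def axis_def)
  have zy: "y \<in> cube z (3 * l / 2)"
    using l by (auto simp: cube_def zi)
  have "cube y l \<subseteq> cube z (2 ^ 4 * (l / 4))"
    using zy l by (intro cube_subset[OF zy]) auto
  then have "W y l \<le> W z (2 ^ 4 * (l / 4))" by (rule W_mono)
  also have "\<dots> \<le> D ^ 4 * W z (l / 4)"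
    using l by (intro W_doubling_pow2) auto
  finally have 1: "W y l \<le> D ^ 4 * W z (l / 4)" .
  have disj: "cube y l \<inter> cube z (l / 4) = {}"
  proof -
    have False if "x \<in> cube y l" "x \<in> cube z (l / 4)" for x
    proof -
      have "\<bar>x $ i0 - y $ i0\<bar> \<le> l / 2" "\<bar>x $ i0 - z $ i0\<bar> \<le> l / 4 / 2"
        using that by (auto simp: cube_def)
      moreover have "z $ i0 = y $ i0 + 3 * l / 4" by (simp add: zi)
      ultimately show False using l by linarith
    qed
    then show ?thesis by auto
  qed
  have "z \<in> cube y (3 * l / 2)" using zy by (simp add: mem_cube_commute)
  then have sub: "cube z (l / 4) \<subseteq> cube y (2 * l)"
    using l by (intro cube_subset) auto
  have "wmeas w (cube y l) + wmeas w (cube z (l / 4)) = wmeas w (cube y l \<union> cube z (l / 4))"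
    using disj by (simp add: wmeas_eq_emeasure[OF weight] plus_emeasure)
  also have "\<dots> \<le> wmeas w (cube y (2 * l))"
    using sub cube_mono[of l "2 * l" y] l by (intro wmeas_mono) auto
  finally have 2: "W y l + W z (l / 4) \<le> W y (2 * l)"
    unfolding wmeas_eq_W by (simp add: W_nonneg flip: ennreal_plus)
  have "W y l * (1 + 1 / D ^ 4) \<le> W y (2 * l)"
  proof -
    have "W y l / D ^ 4 \<le> W z (l / 4)"
      using 1 D_ge_1 by (simp add: divide_le_eq mult.commute)
    then show ?thesis using 2 by (simp add: distrib_left)
  qed
  moreover have "0 < 1 + 1 / D ^ 4"
    using D_ge_1 by (intro add_pos_pos) auto
  ultimately show ?thesis
    unfolding rho_def by (simp add: le_divide_eq)
qed

lemma reverse_doubling_pow2: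
  assumes "0 < l"
  shows "W y l \<le> rho ^ j * W y (2 ^ j * l)"
proof (induction j)
  case (Suc j)
  have "W y (2 ^ j * l) \<le> rho * W y (2 * (2 ^ j * l))"
    using assms by (intro reverse_doubling) simp
  then have "rho ^ j * W y (2 ^ j * l) \<le> rho ^ j * (rho * W y (2 * (2 ^ j * l)))"
    using rho_bounds by (intro mult_left_mono) auto
  with Suc show ?case by (simp add: mult_ac)
qed simp

text \<open>The weak type (1,1) bound for the centred maximal function with respect to the measure
  with density \<open>w\<close>, for cubes of bounded size.\<close>

lemma weak_type_maximal:
  fixes F :: "real ^ 'n \<Rightarrow> ennreal"
  assumes F: "F \<in> borel_measurable lebesgue"
    and S: "\<And>x. x \<in> S \<Longrightarrow> \<exists>l. 0 < l \<and> l \<le> B \<and>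
              ennreal \<tau> * wmeas w (cube x l) \<le> (\<integral>\<^sup>+z\<in>cube x l. F z \<partial>lebesgue)"
  shows "ennreal \<tau> * wmeas w S \<le> ennreal (D ^ 3) * (\<integral>\<^sup>+z. F z \<partial>lebesgue)"
proof -
  let ?n = "sqrt (real CARD('n))"
  obtain L where L: "\<And>x. x \<in> S \<Longrightarrow> 0 < L x" "\<And>x. x \<in> S \<Longrightarrow> L x \<le> B"
    "\<And>x. x \<in> S \<Longrightarrow> ennreal \<tau> * wmeas w (cube x (L x)) \<le> (\<integral>\<^sup>+z\<in>cube x (L x). F z \<partial>lebesgue)"
    using S by metis
  define R where "R x = ?n * L x / 2" for x
  have n1: "1 \<le> ?n" by (rule sqrt_card_ge_1)
  obtain C where C: "countable C" "C \<subseteq> S"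
     "pairwise (\<lambda>i j. disjnt (cball i (R i)) (cball j (R j))) C"
     "S \<subseteq> (\<Union>i\<in>C. cball i (5 * R i))"
  proof (rule Vitali_covering_lemma_cballs[where S = S and K = S and a = "\<lambda>x. x" and r = R and B = "?n * B / 2"])
    show "S \<subseteq> (\<Union>i\<in>S. cball i (R i))"
      using L(1) n1 by (force simp: R_def less_imp_le)
    show "0 < R i \<and> R i \<le> ?n * B / 2" if "i \<in> S" for i
      using L(1,2)[OF that] n1 by (auto simp: R_def)
  qed auto
  \<comment> \<open>Three doublings pass from \<open>Q(i, L i)\<close> to a cube that contains the fivefold ball.\<close>
  have sub: "S \<subseteq> (\<Union>i\<in>C. cube i ((2 * ?n) ^ 3 * L i))"
  proof
    fix x assume "x \<in> S"
    then obtain i where i: "i \<in> C" "x \<in> cball i (5 * R i)" using C by blast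
    have "5 * ?n \<le> (2 * ?n) ^ 3"
    proof -
      have "1 \<le> ?n\<^sup>2" using n1 by (rule one_le_power)
      then have "5 \<le> 8 * ?n\<^sup>2" by linarith
      then have "?n * 5 \<le> ?n * (8 * ?n\<^sup>2)" using n1 by (intro mult_left_mono) linarith+
      then show ?thesis by (simp add: power2_eq_square power3_eq_cube)
    qed
    then have "2 * (5 * R i) \<le> (2 * ?n) ^ 3 * L i"
      using L(1)[of i] i C mult_right_mono[of "5 * ?n" "(2 * ?n) ^ 3" "L i"]
      by (auto simp: R_def mult_ac)
    then show "x \<in> (\<Union>i\<in>C. cube i ((2 * ?n) ^ 3 * L i))"
      using i cball_subset_cube[of i "5 * R i"] cube_mono[of "2 * (5 * R i)"] by blast
  qed
  have "wmeas w S \<le> wmeas w (\<Union>i\<in>C. cube i ((2 * ?n) ^ 3 * L i))"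
    by (rule wmeas_mono[OF sub])
  also have "\<dots> = (\<integral>\<^sup>+z. ennreal (w z) * indicator (\<Union>i\<in>C. cube i ((2 * ?n) ^ 3 * L i)) z \<partial>lebesgue)"
    by (simp add: wmeas_def)
  also have "\<dots> \<le> (\<integral>\<^sup>+z. (\<integral>\<^sup>+i. ennreal (w z) * indicator (cube i ((2 * ?n) ^ 3 * L i)) z \<partial>count_space C) \<partial>lebesgue)"
  proof (intro nn_integral_mono)
    fix z
    show "ennreal (w z) * indicator (\<Union>i\<in>C. cube i ((2 * ?n) ^ 3 * L i)) z
       \<le> (\<integral>\<^sup>+i. ennreal (w z) * indicator (cube i ((2 * ?n) ^ 3 * L i)) z \<partial>count_space C)"
    proof (cases "z \<in> (\<Union>i\<in>C. cube i ((2 * ?n) ^ 3 * L i))")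
      case True
      then obtain i where "i \<in> C" "z \<in> cube i ((2 * ?n) ^ 3 * L i)" by blast
      then show ?thesis
        using nn_integral_ge_point[of i C "\<lambda>i. ennreal (w z) * indicator (cube i ((2 * ?n) ^ 3 * L i)) z"]
        by (auto simp: indicator_def)
    qed simp
  qed
  also have "\<dots> = (\<integral>\<^sup>+i. wmeas w (cube i ((2 * ?n) ^ 3 * L i)) \<partial>count_space C)"
    unfolding wmeas_def using C(1) weight_measurable[OF weight]
    by (intro nn_integral_count_space_nn_integral) auto
  finally have "ennreal \<tau> * wmeas w S
      \<le> ennreal \<tau> * (\<integral>\<^sup>+i. wmeas w (cube i ((2 * ?n) ^ 3 * L i)) \<partial>count_space C)"
    by (intro mult_left_mono) auto
  also have "\<dots> = (\<integral>\<^sup>+i. ennreal \<tau> * wmeas w (cube i ((2 * ?n) ^ 3 * L i)) \<partial>count_space C)"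
    by (simp add: nn_integral_cmult)
  also have "\<dots> \<le> (\<integral>\<^sup>+i. ennreal (D ^ 3) * (\<integral>\<^sup>+z\<in>cube i (L i). F z \<partial>lebesgue) \<partial>count_space C)"
  proof (intro nn_integral_mono)
    fix i assume "i \<in> space (count_space C)"
    then have i: "i \<in> S" using C by auto
    have "ennreal \<tau> * wmeas w (cube i ((2 * ?n) ^ 3 * L i)) \<le> ennreal \<tau> * (ennreal (D ^ 3) * wmeas w (cube i (L i)))"
      by (intro mult_left_mono doubling_iterate L i) simp
    also have "\<dots> = ennreal (D ^ 3) * (ennreal \<tau> * wmeas w (cube i (L i)))"
      by (simp add: mult_ac)
    also have "\<dots> \<le> ennreal (D ^ 3) * (\<integral>\<^sup>+z\<in>cube i (L i). F z \<partial>lebesgue)"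
      by (intro mult_left_mono L i) simp
    finally show "ennreal \<tau> * wmeas w (cube i ((2 * ?n) ^ 3 * L i)) \<le> \<dots>" .
  qed
  also have "\<dots> = ennreal (D ^ 3) * (\<integral>\<^sup>+i. emeasure (density lebesgue F) (cube i (L i)) \<partial>count_space C)"
    using F by (simp add: nn_integral_cmult emeasure_density)
  also have "(\<integral>\<^sup>+i. emeasure (density lebesgue F) (cube i (L i)) \<partial>count_space C)
      = emeasure (density lebesgue F) (\<Union>i\<in>C. cube i (L i))"
  proof (intro emeasure_UN_countable[symmetric])
    show "disjoint_family_on (\<lambda>i. cube i (L i)) C"
      unfolding disjoint_family_on_def
    proof (intro ballI impI)
      fix i j assume ij: "i \<in> C" "j \<in> C" "i \<noteq> j"
      then have "disjnt (cball i (R i)) (cball j (R j))" using C(3) by (auto simp: pairwise_def)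
      moreover have "0 \<le> L i" "0 \<le> L j"
        using L(1) ij C(2) by (meson less_imp_le subsetD)+
      then have "cube i (L i) \<subseteq> cball i (R i)" "cube j (L j) \<subseteq> cball j (R j)"
        unfolding R_def by (simp_all only: cube_subset_cball)
      ultimately show "cube i (L i) \<inter> cube j (L j) = {}"
        unfolding disjnt_def by blast
    qed
  qed (use C in auto)
  also have "\<dots> \<le> emeasure (density lebesgue F) UNIV"
    by (intro emeasure_mono) auto
  also have "\<dots> = (\<integral>\<^sup>+z. F z \<partial>lebesgue)"
    using F by (simp add: emeasure_density)
  finally show ?thesis by (simp add: mult_left_mono)
qed

end

section \<open>Two-sided geometric sums\<close>

text \<open>The terms with \<open>u\<^sub>j \<le> 1\<close> decrease geometrically, those with \<open>u\<^sub>j > 1\<close> increase geometrically up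
  to a last term at most \<open>1\<close>.\<close>

lemma sum_min_powr_le:
  fixes u :: "nat \<Rightarrow> real"
  assumes u: "\<And>j. 0 < u j" "\<And>j. u (Suc j) \<le> \<rho> * u j" and \<rho>: "0 < \<rho>" "\<rho> < 1"
    and ab: "0 < a" "0 < b"
  shows "(\<Sum>j<N. min (u j powr a) (u j powr - b)) \<le> 1 / (1 - \<rho> powr a) + 1 / (1 - \<rho> powr b)"
proof -
  define \<sigma> where "\<sigma> = \<rho> powr a"
  define \<sigma>' where "\<sigma>' = \<rho> powr b"
  have \<sigma>: "0 < \<sigma>" "\<sigma> < 1" "0 < \<sigma>'" "\<sigma>' < 1"
    using \<rho> ab by (auto simp: \<sigma>_def \<sigma>'_def powr01_less_one)
  define v where "v j = u j powr a" for j
  define z where "z j = u j powr - b" for j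
  have pos: "0 < v j" "0 < z j" for j using u(1)[of j] by (auto simp: v_def z_def)
  have v_step: "v (Suc j) \<le> \<sigma> * v j" for j
  proof -
    have "u (Suc j) powr a \<le> (\<rho> * u j) powr a"
      using u[of j] u(1)[of "Suc j"] ab by (intro powr_mono2) auto
    then show ?thesis
      unfolding v_def \<sigma>_def using u(1)[of j] \<rho> by (simp add: powr_mult)
  qed
  have z_step: "z j \<le> \<sigma>' * z (Suc j)" for j
  proof -
    have "u (Suc j) powr b \<le> (\<rho> * u j) powr b"
      using u[of j] u(1)[of "Suc j"] ab by (intro powr_mono2) auto
    then show ?thesis
      unfolding z_def \<sigma>'_def using u(1)[of j] u(1)[of "Suc j"] \<rho>
      by (simp add: powr_minus powr_mult field_simps)
  qed
  have v1: "u j \<le> 1 \<longleftrightarrow> v j \<le> 1" for j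
    unfolding v_def using u(1)[of j] ab powr_le1[of a "u j"] gr_one_powr[of "u j" a] by linarith
  have z1: "u j \<le> 1 \<longleftrightarrow> 1 \<le> z j" for j
  proof -
    have "1 \<le> z j \<longleftrightarrow> u j powr b \<le> 1"
      unfolding z_def using u(1)[of j] by (simp add: powr_minus one_le_inverse_iff)
    then show ?thesis
      using u(1)[of j] ab powr_le1[of b "u j"] gr_one_powr[of "u j" b] by linarith
  qed
  \<comment> \<open>The right-hand sides of the next two bounds are chosen so as to be preserved by adding one term.\<close>
  have S1: "(\<Sum>j<N. if u j \<le> 1 then v j else 0) \<le> (1 - min 1 (v N)) / (1 - \<sigma>)" for N
  proof (induction N)
    case (Suc N)
    show ?case
    proof (cases "u N \<le> 1")
      case True
      then have vN: "v N \<le> 1" by (simp add: v1)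
      have v': "v (Suc N) \<le> v N" using v_step[of N] \<sigma> pos[of N]
        by (meson less_imp_le mult_left_le_one_le order_trans)
      have "(\<Sum>j<Suc N. if u j \<le> 1 then v j else 0) \<le> (1 - v N) / (1 - \<sigma>) + v N"
        using Suc True vN by simp
      also have "\<dots> = (1 - \<sigma> * v N) / (1 - \<sigma>)" using \<sigma> by (simp add: field_simps)
      also have "\<dots> \<le> (1 - min 1 (v (Suc N))) / (1 - \<sigma>)"
        using v_step[of N] \<sigma> by (intro divide_right_mono) auto
      finally show ?thesis .
    next
      case False
      then have "min 1 (v N) = 1" using v1[of N] by simp
      with Suc False have "(\<Sum>j<Suc N. if u j \<le> 1 then v j else 0) \<le> 0" by simp
      also have "\<dots> \<le> (1 - min 1 (v (Suc N))) / (1 - \<sigma>)" using \<sigma> by simp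
      finally show ?thesis .
    qed
  qed (use \<sigma> in auto)
  have S2: "(\<Sum>j<N. if u j \<le> 1 then 0 else z j) \<le> min (1 / (1 - \<sigma>')) (\<sigma>' * z N / (1 - \<sigma>'))" for N
  proof (induction N)
    case 0
    then show ?case using \<sigma> pos[of 0] by simp
  next
    case (Suc N)
    have step: "z N / (1 - \<sigma>') \<le> \<sigma>' * z (Suc N) / (1 - \<sigma>')"
      using z_step[of N] \<sigma> by (intro divide_right_mono) auto
    show ?case
    proof (cases "u N \<le> 1")
      case True
      have "\<sigma>' * z N / (1 - \<sigma>') \<le> z N / (1 - \<sigma>')"
        using \<sigma> pos[of N] by (intro divide_right_mono) auto
      with Suc True step show ?thesis by simp
    next
      case False
      then have zN: "z N \<le> 1" using z1[of N] by simp
      have "(\<Sum>j<Suc N. if u j \<le> 1 then 0 else z j) \<le> \<sigma>' * z N / (1 - \<sigma>') + z N"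
        using Suc False by simp
      also have "\<dots> = z N / (1 - \<sigma>')" using \<sigma> by (simp add: field_simps)
      finally have "(\<Sum>j<Suc N. if u j \<le> 1 then 0 else z j) \<le> z N / (1 - \<sigma>')" .
      moreover have "z N / (1 - \<sigma>') \<le> 1 / (1 - \<sigma>')"
        using zN \<sigma> by (intro divide_right_mono) auto
      ultimately show ?thesis using step by simp
    qed
  qed
  have "(\<Sum>j<N. min (u j powr a) (u j powr - b))
      \<le> (\<Sum>j<N. (if u j \<le> 1 then v j else 0) + (if u j \<le> 1 then 0 else z j))"
    by (intro sum_mono) (auto simp: v_def z_def)
  also have "\<dots> = (\<Sum>j<N. if u j \<le> 1 then v j else 0) + (\<Sum>j<N. if u j \<le> 1 then 0 else z j)"
    by (rule sum.distrib)
  also have "\<dots> \<le> 1 / (1 - \<sigma>) + 1 / (1 - \<sigma>')"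
  proof (rule add_mono)
    have "(1 - min 1 (v N)) / (1 - \<sigma>) \<le> 1 / (1 - \<sigma>)"
      using \<sigma> pos(1)[of N] by (intro divide_right_mono) auto
    then show "(\<Sum>j<N. if u j \<le> 1 then v j else 0) \<le> 1 / (1 - \<sigma>)"
      using S1[of N] by linarith
    show "(\<Sum>j<N. if u j \<le> 1 then 0 else z j) \<le> 1 / (1 - \<sigma>')"
      using S2[of N] by simp
  qed
  finally show ?thesis by (simp add: \<sigma>_def \<sigma>'_def)
qed

section \<open>Outer norms of series\<close>

lemma nn_integral_lebesgue_suminf_mult:
  fixes g :: "nat \<Rightarrow> 'a::euclidean_space \<Rightarrow> ennreal"
  assumes "\<And>j. g j \<in> borel_measurable lebesgue" "m \<in> borel_measurable lebesgue"
  shows "(\<integral>\<^sup>+y. (\<Sum>j. c j * g j y) * m y \<partial>lebesgue) = (\<Sum>j. c j * (\<integral>\<^sup>+y. g j y * m y \<partial>lebesgue))"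
proof -
  note [measurable] = assms
  have "(\<integral>\<^sup>+y. (\<Sum>j. c j * g j y) * m y \<partial>lebesgue) = (\<integral>\<^sup>+y. (\<Sum>j. c j * (g j y * m y)) \<partial>lebesgue)"
    by (simp add: mult.assoc flip: ennreal_suminf_multc)
  also have "\<dots> = (\<Sum>j. (\<integral>\<^sup>+y. c j * (g j y * m y) \<partial>lebesgue))"
    by (rule nn_integral_suminf) measurable
  also have "\<dots> = (\<Sum>j. c j * (\<integral>\<^sup>+y. g j y * m y \<partial>lebesgue))"
    by (intro arg_cong[where f = suminf] ext nn_integral_cmult) measurable
  finally show ?thesis .
qed

text \<open>Jensen's inequality for the power \<open>\<sigma>\<close>, in the form of Hoelder's inequality on the
  counting measure.\<close>

lemma epowr_suminf_le:
  fixes c g :: "nat \<Rightarrow> ennreal"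
  assumes \<sigma>: "1 < \<sigma>"
  shows "epowr (\<Sum>j. c j * g j) \<sigma> \<le> epowr (\<Sum>j. c j) (\<sigma> - 1) * (\<Sum>j. c j * epowr (g j) \<sigma>)"
proof -
  define \<tau> where "\<tau> = \<sigma> / (\<sigma> - 1)"
  have \<tau>: "1 < \<tau>" "1 / \<tau> + 1 / \<sigma> = 1" "\<sigma> / \<tau> = \<sigma> - 1"
    using \<sigma> by (auto simp: \<tau>_def field_simps)
  have split: "epowr (c j) (1 / \<tau>) * epowr (c j) (1 / \<sigma>) = c j" for j
  proof (cases "c j")
    case (real u)
    then show ?thesis using \<sigma> \<tau>
      by (cases "u = 0") (auto simp: epowr_ennreal epowr_0 powr_add[symmetric] simp flip: ennreal_mult)
  next
    case top
    then show ?thesis using \<sigma> \<tau> epowr_top[of "1/\<tau>"] epowr_top[of "1/\<sigma>"] by simp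
  qed
  have "(\<Sum>j. c j * g j) = (\<integral>\<^sup>+j. epowr (c j) (1 / \<tau>) * (epowr (c j) (1 / \<sigma>) * g j) \<partial>count_space UNIV)"
    by (simp add: nn_integral_count_space_nat split flip: mult.assoc)
  also have "\<dots> \<le> epowr (\<integral>\<^sup>+j. epowr (epowr (c j) (1 / \<tau>)) \<tau> \<partial>count_space UNIV) (1 / \<tau>)
      * epowr (\<integral>\<^sup>+j. epowr (epowr (c j) (1 / \<sigma>) * g j) \<sigma> \<partial>count_space UNIV) (1 / \<sigma>)"
    using \<sigma> \<tau> by (intro nn_integral_Holder) auto
  also have "\<dots> = epowr (\<Sum>j. c j) (1 / \<tau>) * epowr (\<Sum>j. c j * epowr (g j) \<sigma>) (1 / \<sigma>)"
    using \<sigma> \<tau> by (simp add: nn_integral_count_space_nat epowr_mult epowr_epowr epowr_one)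
  finally have "epowr (\<Sum>j. c j * g j) \<sigma>
      \<le> epowr (epowr (\<Sum>j. c j) (1 / \<tau>) * epowr (\<Sum>j. c j * epowr (g j) \<sigma>) (1 / \<sigma>)) \<sigma>"
    using \<sigma> by (intro epowr_mono) auto
  also have "\<dots> = epowr (\<Sum>j. c j) (\<sigma> - 1) * (\<Sum>j. c j * epowr (g j) \<sigma>)"
    using \<sigma> \<tau> by (simp add: epowr_mult epowr_epowr epowr_one)
  finally show ?thesis .
qed

text \<open>Minkowski's inequality for series, with a common bound on the norms of the terms.\<close>

lemma Ls_norm_series_le:
  fixes g :: "nat \<Rightarrow> real ^ 'n \<Rightarrow> ennreal"
  assumes s: "1 < s" and \<mu>: "weight \<mu>"
    and G[measurable]: "G \<in> borel_measurable lebesgue"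
    and g[measurable]: "\<And>j. g j \<in> borel_measurable lebesgue"
    and le: "\<And>y. G y \<le> (\<Sum>j. c j * g j y)"
    and A: "\<And>j. Ls_norm s \<mu> (g j) \<le> A"
    and K: "(\<Sum>j. c j) \<le> ennreal K" "0 < K"
  shows "Ls_norm s \<mu> G \<le> ennreal K * A"
proof (cases "s = \<infinity>")
  case True
  have m[measurable]: "(\<lambda>y. ennreal (\<mu> y)) \<in> borel_measurable lebesgue"
    using weight_measurable[OF \<mu>] by simp
  have "AE y in density lebesgue (\<lambda>y. ennreal (\<mu> y)). g j y \<le> A" for j
  proof -
    have "AE y in density lebesgue (\<lambda>y. ennreal (\<mu> y)).
        g j y \<le> esssup (density lebesgue (\<lambda>y. ennreal (\<mu> y))) (g j)"
      by (rule esssup_AE)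
    then show ?thesis
      by eventually_elim (use A[of j] True in \<open>auto simp: Ls_norm_def intro: order_trans\<close>)
  qed
  then have "AE y in density lebesgue (\<lambda>y. ennreal (\<mu> y)). \<forall>j. g j y \<le> A"
    unfolding AE_all_countable by blast
  then have "AE y in density lebesgue (\<lambda>y. ennreal (\<mu> y)). G y \<le> ennreal K * A"
  proof eventually_elim
    case (elim y)
    have "G y \<le> (\<Sum>j. c j * g j y)" by (rule le)
    also have "\<dots> \<le> (\<Sum>j. c j * A)"
      using elim by (intro suminf_le mult_left_mono) auto
    also have "\<dots> = (\<Sum>j. c j) * A" by (rule ennreal_suminf_multc)
    also have "\<dots> \<le> ennreal K * A" by (intro mult_right_mono K) simp
    finally show ?case .
  qed
  then show ?thesis
    unfolding Ls_norm_def using True G by (auto intro!: esssup_I)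
next
  case False
  define \<sigma> where "\<sigma> = enn2real s"
  have \<sigma>: "1 < \<sigma>"
    using s False unfolding \<sigma>_def by (cases s) auto
  have m[measurable]: "(\<lambda>y. ennreal (\<mu> y)) \<in> borel_measurable lebesgue"
    using weight_measurable[OF \<mu>] by simp
  have I: "(\<integral>\<^sup>+y. epowr (g j y) \<sigma> * ennreal (\<mu> y) \<partial>lebesgue) \<le> epowr A \<sigma>" for j
  proof -
    have "epowr (epowr (\<integral>\<^sup>+y. epowr (g j y) \<sigma> * ennreal (\<mu> y) \<partial>lebesgue) (1 / \<sigma>)) \<sigma> \<le> epowr A \<sigma>"
      using A[of j] False \<sigma> by (intro epowr_mono) (auto simp: Ls_norm_def \<sigma>_def)
    then show ?thesis using \<sigma> by (simp add: epowr_epowr epowr_one)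
  qed
  have "(\<integral>\<^sup>+y. epowr (G y) \<sigma> * ennreal (\<mu> y) \<partial>lebesgue)
      \<le> (\<integral>\<^sup>+y. epowr (ennreal K) (\<sigma> - 1) * ((\<Sum>j. c j * epowr (g j y) \<sigma>) * ennreal (\<mu> y)) \<partial>lebesgue)"
  proof (intro nn_integral_mono)
    fix y
    have "epowr (G y) \<sigma> \<le> epowr (\<Sum>j. c j * g j y) \<sigma>"
      using \<sigma> by (intro epowr_mono le) auto
    also have "\<dots> \<le> epowr (\<Sum>j. c j) (\<sigma> - 1) * (\<Sum>j. c j * epowr (g j y) \<sigma>)"
      by (rule epowr_suminf_le[OF \<sigma>])
    also have "\<dots> \<le> epowr (ennreal K) (\<sigma> - 1) * (\<Sum>j. c j * epowr (g j y) \<sigma>)"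
      using \<sigma> by (intro mult_right_mono epowr_mono K) auto
    finally show "epowr (G y) \<sigma> * ennreal (\<mu> y)
        \<le> epowr (ennreal K) (\<sigma> - 1) * ((\<Sum>j. c j * epowr (g j y) \<sigma>) * ennreal (\<mu> y))"
      unfolding mult.assoc[symmetric] by (intro mult_right_mono) auto
  qed
  also have "\<dots> = epowr (ennreal K) (\<sigma> - 1) *
      (\<integral>\<^sup>+y. (\<Sum>j. c j * epowr (g j y) \<sigma>) * ennreal (\<mu> y) \<partial>lebesgue)"
    by (intro nn_integral_cmult) measurable
  also have "(\<integral>\<^sup>+y. (\<Sum>j. c j * epowr (g j y) \<sigma>) * ennreal (\<mu> y) \<partial>lebesgue)
      = (\<Sum>j. c j * (\<integral>\<^sup>+y. epowr (g j y) \<sigma> * ennreal (\<mu> y) \<partial>lebesgue))"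
    by (intro nn_integral_lebesgue_suminf_mult) measurable
  also have "\<dots> \<le> (\<Sum>j. c j * epowr A \<sigma>)"
    by (intro suminf_le mult_left_mono I) auto
  also have "\<dots> = (\<Sum>j. c j) * epowr A \<sigma>" by (rule ennreal_suminf_multc)
  also have "\<dots> \<le> ennreal K * epowr A \<sigma>" by (intro mult_right_mono K) simp
  also have "epowr (ennreal K) (\<sigma> - 1) * (ennreal K * epowr A \<sigma>) = epowr (ennreal K * A) \<sigma>"
  proof -
    have "epowr (ennreal K) (\<sigma> - 1) * ennreal K = epowr (ennreal K) \<sigma>"
      using K \<sigma> by (simp add: epowr_ennreal powr_diff flip: ennreal_mult)
    then show ?thesis using \<sigma> by (simp add: epowr_mult flip: mult.assoc)
  qed
  finally have "(\<integral>\<^sup>+y. epowr (G y) \<sigma> * ennreal (\<mu> y) \<partial>lebesgue) \<le> epowr (ennreal K * A) \<sigma>"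
    by (simp add: mult_left_mono)
  then have "epowr (\<integral>\<^sup>+y. epowr (G y) \<sigma> * ennreal (\<mu> y) \<partial>lebesgue) (1 / \<sigma>)
      \<le> epowr (epowr (ennreal K * A) \<sigma>) (1 / \<sigma>)"
    using \<sigma> by (intro epowr_mono) auto
  also have "\<dots> = ennreal K * A"
    using \<sigma> by (simp add: epowr_epowr epowr_one)
  finally show ?thesis
    using False by (simp add: Ls_norm_def \<sigma>_def)
qed

lemma Ls_norm_finite_AE:
  assumes s: "0 < s" and \<mu>: "weight \<mu>" and G[measurable]: "G \<in> borel_measurable lebesgue"
    and fin: "Ls_norm s \<mu> G < \<infinity>"
  shows "AE y in lebesgue. 0 < \<mu> y \<longrightarrow> G y < \<infinity>"
proof (cases "s = \<infinity>")
  case True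
  have m[measurable]: "(\<lambda>y. ennreal (\<mu> y)) \<in> borel_measurable lebesgue"
    using weight_measurable[OF \<mu>] by simp
  have "AE y in density lebesgue (\<lambda>y. ennreal (\<mu> y)).
      G y \<le> esssup (density lebesgue (\<lambda>y. ennreal (\<mu> y))) G"
    by (rule esssup_AE)
  then show ?thesis
    unfolding AE_density[OF m]
    by eventually_elim (use fin True in \<open>auto simp: Ls_norm_def intro: le_less_trans\<close>)
next
  case False
  have m[measurable]: "(\<lambda>y. ennreal (\<mu> y)) \<in> borel_measurable lebesgue"
    using weight_measurable[OF \<mu>] by simp
  define \<sigma> where "\<sigma> = enn2real s"
  have \<sigma>: "0 < \<sigma>"
    using s False unfolding \<sigma>_def by (cases s) auto
  have "epowr (\<integral>\<^sup>+y. epowr (G y) \<sigma> * ennreal (\<mu> y) \<partial>lebesgue) (1 / \<sigma>) \<noteq> \<infinity>"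
    using fin False unfolding Ls_norm_def \<sigma>_def by simp
  moreover have "0 < 1 / \<sigma>" using \<sigma> by simp
  ultimately have "(\<integral>\<^sup>+y. epowr (G y) \<sigma> * ennreal (\<mu> y) \<partial>lebesgue) \<noteq> \<infinity>"
    by (simp only: epowr_eq_top_iff not_False_eq_True)
  then have "AE y in lebesgue. epowr (G y) \<sigma> * ennreal (\<mu> y) \<noteq> \<infinity>"
    by (intro nn_integral_PInf_AE) measurable
  then show ?thesis
  proof eventually_elim
    case (elim y)
    show ?case
    proof
      assume "0 < \<mu> y"
      then have "epowr (G y) \<sigma> \<noteq> \<infinity>"
        using elim by (auto simp: ennreal_mult_eq_top_iff ennreal_eq_0_iff)
      then show "G y < \<infinity>"
        unfolding epowr_eq_top_iff[OF \<sigma>] by (simp add: less_top)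
    qed
  qed
qed

section \<open>The Riesz kernel\<close>

text \<open>For \<open>x = y\<close> the left-hand side is \<open>0\<close>, because \<open>0 powr \<kappa> = 0\<close> and \<open>inverse 0 = 0\<close>.\<close>

lemma riesz_kernel_le:
  fixes x y :: "real ^ 'n"
  assumes l: "0 < l" and \<kappa>: "0 < \<kappa>"
  shows "ennreal (inverse (norm (x - y) powr \<kappa>)) \<le> ennreal (4 powr \<kappa>) *
    ((\<Sum>j. ennreal ((l / 2 ^ j) powr - \<kappa>) * indicator (cube x (l / 2 ^ j)) y) +
     (\<Sum>j. ennreal ((l * 2 ^ Suc j) powr - \<kappa>) * indicator (cube x (l * 2 ^ Suc j)) y))"
    (is "_ \<le> _ * (?S1 + ?S2)")
proof (cases "x = y")
  case True
  then show ?thesis by simp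
next
  case False
  define r where "r = norm (x - y)"
  have r: "0 < r" using False by (simp add: r_def)
  \<comment> \<open>One cube \<open>Q(x, m)\<close> that contains \<open>y\<close>, with \<open>m\<close> comparable to \<open>r\<close>, gives the bound.\<close>
  have key: "ennreal (inverse (r powr \<kappa>)) \<le> ennreal (4 powr \<kappa>) * (ennreal (m powr - \<kappa>) * indicator (cube x m) y)"
    if m: "2 * r \<le> m" "m < 4 * r" for m
  proof -
    have "y \<in> cball x r" by (simp add: r_def dist_norm)
    then have "y \<in> cube x (2 * r)" using cball_subset_cube by blast
    then have y: "y \<in> cube x m" using cube_mono[OF m(1)] by blast
    have "inverse (r powr \<kappa>) = 4 powr \<kappa> * (4 * r) powr - \<kappa>"
      using r by (simp add: powr_mult powr_minus)
    also have "\<dots> \<le> 4 powr \<kappa> * m powr - \<kappa>"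
      using m r \<kappa> by (intro mult_left_mono powr_mono2') auto
    finally show ?thesis using y by (simp flip: ennreal_mult)
  qed
  have term_le: "h j \<le> (\<Sum>j. h j)" for h :: "nat \<Rightarrow> ennreal" and j
    using sum_le_suminf[of h "{j}"] by simp
  show ?thesis
  proof (cases "2 * r \<le> l")
    case True
    obtain k0 where "l / r < 2 ^ k0" using real_arch_pow[of 2 "l / r"] by auto
    then have "l < r * 2 ^ k0" using r by (simp add: field_simps)
    also have "\<dots> \<le> r * (4 * 2 ^ k0)" using r by simp
    finally have "l / 2 ^ Suc k0 < 2 * r" by (simp add: field_simps)
    define j where "j = (LEAST j. l / 2 ^ Suc j < 2 * r)"
    have j1: "l / 2 ^ Suc j < 2 * r"
      unfolding j_def by (rule LeastI[of _ k0]) fact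
    have j2: "2 * r \<le> l / 2 ^ j"
    proof (cases j)
      case 0
      then show ?thesis using True by simp
    next
      case (Suc i)
      then have "\<not> l / 2 ^ Suc i < 2 * r"
        using not_less_Least[of i "\<lambda>j. l / 2 ^ Suc j < 2 * r"] by (simp add: j_def)
      then show ?thesis using Suc by simp
    qed
    have "ennreal (inverse (r powr \<kappa>)) \<le> ennreal (4 powr \<kappa>) *
        (ennreal ((l / 2 ^ j) powr - \<kappa>) * indicator (cube x (l / 2 ^ j)) y)"
      using j1 j2 by (intro key) (auto simp: field_simps)
    also have "\<dots> \<le> ennreal (4 powr \<kappa>) * ?S1"
      by (intro mult_left_mono term_le) simp
    also have "\<dots> \<le> ennreal (4 powr \<kappa>) * (?S1 + ?S2)"
      by (intro mult_left_mono) auto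
    finally show ?thesis by (simp add: r_def)
  next
    case False
    obtain k0 where "r / l < 2 ^ k0" using real_arch_pow[of 2 "r / l"] by auto
    then have "2 * r \<le> l * 2 ^ Suc k0" using l by (simp add: field_simps)
    define j where "j = (LEAST j. 2 * r \<le> l * 2 ^ Suc j)"
    have j1: "2 * r \<le> l * 2 ^ Suc j"
      unfolding j_def by (rule LeastI[of _ k0]) fact
    have j2: "l * 2 ^ j < 2 * r"
    proof (cases j)
      case 0
      then show ?thesis using False by simp
    next
      case (Suc i)
      then have "\<not> 2 * r \<le> l * 2 ^ Suc i"
        using not_less_Least[of i "\<lambda>j. 2 * r \<le> l * 2 ^ Suc j"] by (simp add: j_def)
      then show ?thesis using Suc by simp
    qed
    have "ennreal (inverse (r powr \<kappa>)) \<le> ennreal (4 powr \<kappa>) *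
        (ennreal ((l * 2 ^ Suc j) powr - \<kappa>) * indicator (cube x (l * 2 ^ Suc j)) y)"
      using j1 j2 by (intro key) auto
    also have "\<dots> \<le> ennreal (4 powr \<kappa>) * ?S2"
      by (intro mult_left_mono term_le) simp
    also have "\<dots> \<le> ennreal (4 powr \<kappa>) * (?S1 + ?S2)"
      by (intro mult_left_mono) auto
    finally show ?thesis by (simp add: r_def)
  qed
qed

text \<open>The fractional average \<open>l\<^sup>-\<^sup>\<kappa> \<integral>\<^sub>Q \<bar>f\<bar>\<close> over the cube \<open>Q = Q(x, l)\<close>; for \<open>\<kappa> = n - \<gamma>\<close>
  this is \<open>\<bar>Q\<bar>\<close> to the power \<open>\<gamma> / n\<close> times the average of \<open>\<bar>f\<bar>\<close> over \<open>Q\<close>.\<close>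

definition frac_avg :: "real \<Rightarrow> (real ^ 'n \<Rightarrow> complex) \<Rightarrow> real ^ 'n \<Rightarrow> real \<Rightarrow> ennreal" where
  "frac_avg \<kappa> f x l = ennreal (l powr - \<kappa>) * (\<integral>\<^sup>+y\<in>cube x l. ennreal (norm (f y)) \<partial>lebesgue)"

text \<open>The two parts of the dyadic majorant of the fractional integral: cubes of size at most
  \<open>l\<close> and cubes of size greater than \<open>l\<close>.\<close>

definition near_sum :: "real \<Rightarrow> (real ^ 'n \<Rightarrow> complex) \<Rightarrow> real ^ 'n \<Rightarrow> real \<Rightarrow> ennreal" where
  "near_sum \<kappa> f x l = (\<Sum>j. frac_avg \<kappa> f x (l / 2 ^ j))"

definition far_sum :: "real \<Rightarrow> (real ^ 'n \<Rightarrow> complex) \<Rightarrow> real ^ 'n \<Rightarrow> real \<Rightarrow> ennreal" where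
  "far_sum \<kappa> f x l = (\<Sum>j. frac_avg \<kappa> f x (l * 2 ^ Suc j))"

lemma nn_integral_cube_series:
  fixes f :: "real ^ 'n \<Rightarrow> complex"
  assumes [measurable]: "f \<in> borel_measurable lebesgue"
  shows "(\<integral>\<^sup>+y. ennreal (norm (f y)) * (\<Sum>j. ennreal (m j powr - \<kappa>) * indicator (cube x (m j)) y) \<partial>lebesgue)
    = (\<Sum>j. frac_avg \<kappa> f x (m j))"
proof -
  have "(\<integral>\<^sup>+y. ennreal (norm (f y)) * (\<Sum>j. ennreal (m j powr - \<kappa>) * indicator (cube x (m j)) y) \<partial>lebesgue)
     = (\<integral>\<^sup>+y. (\<Sum>j. ennreal (m j powr - \<kappa>) * indicator (cube x (m j)) y) * ennreal (norm (f y)) \<partial>lebesgue)"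
    by (simp add: mult.commute)
  also have "\<dots> = (\<Sum>j. frac_avg \<kappa> f x (m j))"
    unfolding frac_avg_def by (subst nn_integral_lebesgue_suminf_mult) (auto simp: mult.commute)
  finally show ?thesis .
qed

lemma nn_integral_riesz_le:
  fixes f :: "real ^ 'n \<Rightarrow> complex"
  assumes f[measurable]: "f \<in> borel_measurable lebesgue" and l: "0 < l" and \<gamma>: "\<gamma> < real CARD('n)"
  defines "\<kappa> \<equiv> real CARD('n) - \<gamma>"
  shows "(\<integral>\<^sup>+y. ennreal (norm (riesz_integrand \<gamma> f x y)) \<partial>lebesgue)
    \<le> ennreal (4 powr \<kappa>) * (near_sum \<kappa> f x l + far_sum \<kappa> f x l)"
proof -
  let ?S1 = "\<lambda>y. \<Sum>j. ennreal ((l / 2 ^ j) powr - \<kappa>) * indicator (cube x (l / 2 ^ j)) y"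
  let ?S2 = "\<lambda>y. \<Sum>j. ennreal ((l * 2 ^ Suc j) powr - \<kappa>) * indicator (cube x (l * 2 ^ Suc j)) y"
  have \<kappa>: "0 < \<kappa>" using \<gamma> by (simp add: \<kappa>_def)
  have "(\<integral>\<^sup>+y. ennreal (norm (riesz_integrand \<gamma> f x y)) \<partial>lebesgue)
      \<le> (\<integral>\<^sup>+y. ennreal (4 powr \<kappa>) * (ennreal (norm (f y)) * ?S1 y + ennreal (norm (f y)) * ?S2 y) \<partial>lebesgue)"
  proof (intro nn_integral_mono)
    fix y
    have "ennreal (norm (riesz_integrand \<gamma> f x y))
        = ennreal (norm (f y)) * ennreal (inverse (norm (x - y) powr \<kappa>))"
      by (simp add: riesz_integrand_def \<kappa>_def mult.commute flip: ennreal_mult)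
    also have "\<dots> \<le> ennreal (norm (f y)) * (ennreal (4 powr \<kappa>) * (?S1 y + ?S2 y))"
      by (intro mult_left_mono riesz_kernel_le l \<kappa>) simp
    also have "\<dots> = ennreal (4 powr \<kappa>) * (ennreal (norm (f y)) * ?S1 y + ennreal (norm (f y)) * ?S2 y)"
      by (simp only: distrib_left mult_ac)
    finally show "ennreal (norm (riesz_integrand \<gamma> f x y)) \<le> \<dots>" .
  qed
  also have "\<dots> = ennreal (4 powr \<kappa>) * ((\<integral>\<^sup>+y. ennreal (norm (f y)) * ?S1 y \<partial>lebesgue)
      + (\<integral>\<^sup>+y. ennreal (norm (f y)) * ?S2 y \<partial>lebesgue))"
    by (subst nn_integral_cmult, measurable, subst nn_integral_add, measurable)
  also have "\<dots> = ennreal (4 powr \<kappa>) * (near_sum \<kappa> f x l + far_sum \<kappa> f x l)"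
    unfolding near_sum_def far_sum_def by (simp only: nn_integral_cube_series[OF f])
  finally show ?thesis .
qed

lemma norm_frac_integral_le:
  fixes f :: "real ^ 'n \<Rightarrow> complex"
  assumes "0 < \<gamma>" "\<gamma> < real CARD('n)"
  shows "ennreal (norm (frac_integral \<gamma> f x))
    \<le> ennreal (1 / zeta_const CARD('n) \<gamma>) * (\<integral>\<^sup>+y. ennreal (norm (riesz_integrand \<gamma> f x y)) \<partial>lebesgue)"
proof -
  have \<zeta>: "0 < zeta_const CARD('n) \<gamma>"
    using assms by (simp add: zeta_const_def Gamma_real_pos)
  have "ennreal (norm (integral\<^sup>L lebesgue (riesz_integrand \<gamma> f x)))
      \<le> (\<integral>\<^sup>+y. ennreal (norm (riesz_integrand \<gamma> f x y)) \<partial>lebesgue)"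
    by (cases "integrable lebesgue (riesz_integrand \<gamma> f x)")
       (auto simp: integral_norm_bound_ennreal not_integrable_integral_eq)
  then have "ennreal (1 / zeta_const CARD('n) \<gamma>) * ennreal (norm (integral\<^sup>L lebesgue (riesz_integrand \<gamma> f x)))
      \<le> ennreal (1 / zeta_const CARD('n) \<gamma>) * (\<integral>\<^sup>+y. ennreal (norm (riesz_integrand \<gamma> f x y)) \<partial>lebesgue)"
    by (intro mult_left_mono) auto
  then show ?thesis
    using \<zeta> by (simp add: frac_integral_def divide_inverse flip: ennreal_mult)
qed

section \<open>Measurability\<close>

lemma complex_ex_borel_measurable:
  fixes f :: "'a::euclidean_space \<Rightarrow> complex"
  assumes "f \<in> borel_measurable lebesgue"
  shows "\<exists>g \<in> borel_measurable borel. AE x in lebesgue. f x = g x"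
proof -
  have "(\<lambda>x. Re (f x)) \<in> borel_measurable lebesgue" "(\<lambda>x. Im (f x)) \<in> borel_measurable lebesgue"
    using assms by measurable
  from this[THEN completion_ex_borel_measurable_real]
  obtain u v where [measurable]: "u \<in> borel_measurable borel" "v \<in> borel_measurable borel"
    and ae: "AE x in lborel. Re (f x) = u x" "AE x in lborel. Im (f x) = v x" by auto
  have "(\<lambda>x. Complex (u x) (v x)) \<in> borel_measurable borel"
    unfolding Complex_eq by measurable
  moreover have "AE x in lebesgue. f x = Complex (u x) (v x)"
    using ae[THEN AE_completion] by eventually_elim (simp add: complex_eq_iff)
  ultimately show ?thesis by (intro bexI[of _ "\<lambda>x. Complex (u x) (v x)"])
qed

lemma measurable_riesz_integrand [measurable (raw)]:
  fixes f :: "real ^ 'n \<Rightarrow> complex"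
  assumes [measurable]: "f \<in> borel_measurable lebesgue"
  shows "riesz_integrand \<gamma> f x \<in> borel_measurable lebesgue"
proof -
  have "(\<lambda>y. inverse (norm (x - y) powr (real CARD('n) - \<gamma>))) \<in> borel_measurable borel"
    by measurable
  then have [measurable]: "(\<lambda>y. inverse (norm (x - y) powr (real CARD('n) - \<gamma>))) \<in> borel_measurable lebesgue"
    by (intro measurable_completion) simp
  show ?thesis
    unfolding riesz_integrand_def[abs_def] by measurable
qed

lemma measurable_frac_integral:
  fixes f :: "real ^ 'n \<Rightarrow> complex"
  assumes f: "f \<in> borel_measurable lebesgue"
  shows "frac_integral \<gamma> f \<in> borel_measurable lebesgue"
proof -
  obtain g where g[measurable]: "g \<in> borel_measurable borel" and ae: "AE x in lebesgue. f x = g x"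
    using complex_ex_borel_measurable[OF f] by auto
  have g': "g \<in> borel_measurable lebesgue"
    using g by (intro measurable_completion) simp
  have "integral\<^sup>L lebesgue (riesz_integrand \<gamma> f x) = integral\<^sup>L lborel (riesz_integrand \<gamma> g x)" for x
  proof -
    have "integral\<^sup>L lebesgue (riesz_integrand \<gamma> f x) = integral\<^sup>L lebesgue (riesz_integrand \<gamma> g x)"
      by (intro integral_cong_AE measurable_riesz_integrand f g')
         (use ae in \<open>eventually_elim, simp add: riesz_integrand_def\<close>)
    also have "\<dots> = integral\<^sup>L lborel (riesz_integrand \<gamma> g x)"
      by (rule integral_completion) (simp add: riesz_integrand_def[abs_def])
    finally show ?thesis .
  qed
  then have "frac_integral \<gamma> f = (\<lambda>x. (\<integral>y. riesz_integrand \<gamma> g x y \<partial>lborel) /\<^sub>R zeta_const CARD('n) \<gamma>)"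
    by (simp add: frac_integral_def fun_eq_iff)
  also have "\<dots> \<in> borel_measurable borel"
    unfolding riesz_integrand_def[abs_def] by measurable
  finally show ?thesis
    by (intro measurable_completion) simp
qed

lemma ennreal_mult_le_from_below:
  fixes c S :: ennreal
  assumes "0 < t" "\<And>u. u \<in> \<rat> \<Longrightarrow> 0 < u \<Longrightarrow> u < t \<Longrightarrow> ennreal u * c \<le> S"
  shows "ennreal t * c \<le> S"
proof (cases "c = 0 \<or> S = \<infinity>")
  case True
  then show ?thesis by auto
next
  case False
  obtain u0 where u0: "u0 \<in> \<rat>" "0 < u0" "u0 < t" using Rats_dense_in_real[OF assms(1)] by auto
  have "c \<noteq> \<infinity>"
    using assms(2)[OF u0] False u0 by (auto simp: ennreal_mult_top top_unique)
  then obtain d where d: "c = ennreal d" "0 < d" using False by (cases c) (auto simp: less_le)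
  obtain a where a: "S = ennreal a" "0 \<le> a" using False by (cases S) auto
  have "t * d \<le> a"
  proof (rule ccontr)
    assume "\<not> t * d \<le> a"
    then have "a / d < t" using d by (simp add: field_simps)
    then obtain u where u: "u \<in> \<rat>" "a / d < u" "u < t" using Rats_dense_in_real by blast
    have "0 < u" using u(2) a d by (meson divide_nonneg_pos le_less_trans)
    with assms(2)[OF u(1)] u have "u * d \<le> a" using a d by (simp flip: ennreal_mult)
    with u(2) d show False by (simp add: field_simps)
  qed
  moreover have "ennreal t * c = ennreal (t * d)"
    using d assms(1) by (simp add: ennreal_mult)
  ultimately show ?thesis unfolding a(1) by (simp only: ennreal_leI)
qed

text \<open>A countable supremum, from which the measurability of the weak norm over \<open>Q(y, l)\<close> as a function
  of \<open>y\<close> follows. It matters for \<open>s = \<infinity>\<close>, as the essential supremum of a function that is not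
  measurable is \<open>\<infinity>\<close> by definition.\<close>

lemma WLp_norm_eq_SUP_Rats:
  assumes q: "0 < q"
  shows "WLp_norm q w f = (SUP t\<in>{t\<in>\<rat>. 0 < t}. ennreal t * epowr (wmeas w {x. norm (f x) > t}) (1 / q))"
    (is "_ = ?S")
proof (rule antisym)
  show "?S \<le> WLp_norm q w f"
    unfolding WLp_norm_def by (rule SUP_subset_mono, blast, rule order_refl)
  show "WLp_norm q w f \<le> ?S"
    unfolding WLp_norm_def
  proof (intro SUP_least)
    fix t :: real assume "t \<in> {0<..}"
    then have "0 < t" by simp
    then show "ennreal t * epowr (wmeas w {x. norm (f x) > t}) (1 / q) \<le> ?S"
    proof (rule ennreal_mult_le_from_below)
      fix u :: real assume u: "u \<in> \<rat>" "0 < u" "u < t"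
      have "{x. norm (f x) > t} \<subseteq> {x. norm (f x) > u}" using u by auto
      then have "ennreal u * epowr (wmeas w {x. norm (f x) > t}) (1 / q)
          \<le> ennreal u * epowr (wmeas w {x. norm (f x) > u}) (1 / q)"
        using q by (intro mult_left_mono epowr_mono wmeas_mono zero_le) simp_all
      also have "\<dots> \<le> ?S"
        using u by (intro SUP_upper) simp
      finally show "ennreal u * epowr (wmeas w {x. norm (f x) > t}) (1 / q) \<le> ?S" .
    qed
  qed
qed

lemma wmeas_superlevel_restrict:
  assumes "0 < t"
  shows "wmeas w {x. norm (restrict_to Q f x) > t}
    = (\<integral>\<^sup>+x\<in>Q. ennreal (w x) * indicator {x. norm (f x) > t} x \<partial>lebesgue)"
  unfolding wmeas_def using assms
  by (intro nn_integral_cong) (auto simp: restrict_to_def indicator_def)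

lemma measurable_WLp_norm:
  fixes f :: "real ^ 'n \<Rightarrow> complex"
  assumes f: "f \<in> borel_measurable lebesgue" and w: "weight w" and q: "0 < q"
  shows "(\<lambda>y. WLp_norm q w (restrict_to (cube y l) f)) \<in> borel_measurable borel"
  unfolding WLp_norm_eq_SUP_Rats[OF q]
proof (intro borel_measurable_SUP)
  show "countable {t \<in> \<rat>. (0::real) < t}"
    using countable_rat by (rule countable_subset[rotated]) auto
  fix t :: real assume "t \<in> {t \<in> \<rat>. 0 < t}"
  then have "0 < t" by simp
  have "(\<lambda>x. ennreal (w x) * indicator {x. norm (f x) > t} x) \<in> borel_measurable lebesgue"
    using f weight_measurable[OF w] by measurable
  from measurable_cube_integral[OF this, of l]
  have [measurable]: "(\<lambda>y. wmeas w {x. norm (restrict_to (cube y l) f x) > t}) \<in> borel_measurable borel"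
    by (simp only: wmeas_superlevel_restrict[OF \<open>0 < t\<close>])
  show "(\<lambda>y. ennreal t * epowr (wmeas w {x. norm (restrict_to (cube y l) f x) > t}) (1 / q)) \<in> borel_measurable borel"
    by measurable
qed

lemma Lp_norm_restrict:
  assumes "0 < p"
  shows "Lp_norm p \<nu> (restrict_to Q f)
    = epowr (\<integral>\<^sup>+x\<in>Q. ennreal (norm (f x) powr p * \<nu> x) \<partial>lebesgue) (1 / p)"
  unfolding Lp_norm_def using assms
  by (intro arg_cong2[where f = epowr] nn_integral_cong refl) (auto simp: restrict_to_def indicator_def)

lemma measurable_Lp_norm:
  fixes f :: "real ^ 'n \<Rightarrow> complex"
  assumes f: "f \<in> borel_measurable lebesgue" and \<nu>: "weight \<nu>" and p: "0 < p"
  shows "(\<lambda>y. Lp_norm p \<nu> (restrict_to (cube y l) f)) \<in> borel_measurable borel"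
proof -
  have "(\<lambda>x. ennreal (norm (f x) powr p * \<nu> x)) \<in> borel_measurable lebesgue"
    using f weight_measurable[OF \<nu>] by measurable
  from measurable_cube_integral[OF this, of l] show ?thesis
    unfolding Lp_norm_restrict[OF p] by (rule measurable_epowr)
qed

lemma measurable_wmeas_cube:
  assumes "weight w"
  shows "(\<lambda>y. wmeas w (cube y l)) \<in> borel_measurable borel"
proof -
  have "(\<lambda>x. ennreal (w x)) \<in> borel_measurable lebesgue"
    using weight_measurable[OF assms] by simp
  from measurable_cube_integral[OF this] show ?thesis
    unfolding wmeas_def .
qed

section \<open>The bump condition and fractional averages\<close>

lemma cube_avg_power_mean:
  fixes u :: "real ^ 'n \<Rightarrow> ennreal"
  assumes u[measurable]: "u \<in> borel_measurable lebesgue" and l: "0 < l" and r: "1 < r"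
  shows "cube_avg u (cube y l) \<le> epowr (cube_avg (\<lambda>x. epowr (u x) r) (cube y l)) (1 / r)"
proof -
  define N where "N = l powr real CARD('n)"
  have N: "0 < N" "emeasure lebesgue (cube y l) = ennreal N"
    using l emeasure_cube[OF l, of y] by (simp_all add: N_def)
  define r' where "r' = r / (r - 1)"
  have r': "1 < r'" "1 / r + 1 / r' = 1" using r by (auto simp: r'_def field_simps)
  define V where "V = (\<integral>\<^sup>+x\<in>cube y l. epowr (u x) r \<partial>lebesgue)"
  have "(\<integral>\<^sup>+x\<in>cube y l. u x \<partial>lebesgue)
      = (\<integral>\<^sup>+x. (u x * indicator (cube y l) x) * indicator (cube y l) x \<partial>lebesgue)"
    by (intro nn_integral_cong) (auto simp: indicator_def)
  also have "\<dots> \<le> epowr (\<integral>\<^sup>+x. epowr (u x * indicator (cube y l) x) r \<partial>lebesgue) (1 / r)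
      * epowr (\<integral>\<^sup>+x. epowr (indicator (cube y l) x) r' \<partial>lebesgue) (1 / r')"
    using r r' by (intro nn_integral_Holder) auto
  also have "(\<integral>\<^sup>+x. epowr (u x * indicator (cube y l) x) r \<partial>lebesgue) = V"
    unfolding V_def using r by (intro nn_integral_cong) (auto simp: indicator_def epowr_0)
  also have "(\<integral>\<^sup>+x. epowr (indicator (cube y l) x) r' \<partial>lebesgue) = (\<integral>\<^sup>+x. indicator (cube y l) x \<partial>lebesgue)"
    using r' by (intro nn_integral_cong) (auto simp: indicator_def epowr_0 epowr_def)
  also have "\<dots> = ennreal N" by (simp add: N)
  finally have le: "(\<integral>\<^sup>+x\<in>cube y l. u x \<partial>lebesgue) \<le> epowr V (1 / r) * epowr (ennreal N) (1 / r')" .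
  show ?thesis
  proof (cases V)
    case (real v)
    have "epowr V (1 / r) * epowr (ennreal N) (1 / r') = ennreal (v powr (1 / r) * N powr (1 / r'))"
      using real N r r' by (simp add: epowr_ennreal_nonneg flip: ennreal_mult)
    also have "\<dots> = ennreal N * epowr (ennreal (v / N)) (1 / r)"
    proof -
      have "1 / r' = 1 - 1 / r" using r' by simp
      then have "v powr (1 / r) * N powr (1 / r') = N * (v / N) powr (1 / r)"
        using N real by (simp add: powr_divide powr_diff)
      then show ?thesis
        using real N r by (simp add: epowr_ennreal_nonneg flip: ennreal_mult)
    qed
    finally have "(\<integral>\<^sup>+x\<in>cube y l. u x \<partial>lebesgue) \<le> ennreal N * epowr (ennreal (v / N)) (1 / r)"
      using le by simp
    then have "(\<integral>\<^sup>+x\<in>cube y l. u x \<partial>lebesgue) / ennreal N \<le> epowr (ennreal (v / N)) (1 / r)"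
      using N by (simp add: divide_le_posI_ennreal)
    then show ?thesis
      using real N by (simp add: cube_avg_def V_def[symmetric] divide_ennreal)
  next
    case top
    then have "cube_avg (\<lambda>x. epowr (u x) r) (cube y l) = \<infinity>"
      using N by (simp add: cube_avg_def V_def[symmetric] ennreal_top_divide)
    then show ?thesis using r epowr_top[of "1 / r"] by simp
  qed
qed

text \<open>The bump condition over a cube bounds the fractional average of every \<open>f\<close> over that cube. The power \<open>r\<close>
  is used only through the power mean inequality.\<close>

lemma (in doubling_weight) frac_avg_le_of_bump:
  fixes f :: "real ^ 'n \<Rightarrow> complex"
  assumes \<nu>: "weight \<nu>" and f: "f \<in> borel_measurable lebesgue"
    and l: "0 < l" and p: "1 < p" and q: "0 < q" and r: "1 < r" and C: "0 \<le> C"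
    and bump: "epowr (emeasure lebesgue (cube y l)) (\<gamma> / real CARD('n) + 1 / q - 1 / p)
           * epowr (cube_avg (\<lambda>x. epowr (ennreal (w x)) r) (cube y l)) (1 / (r * q))
           * epowr (cube_avg (\<lambda>x. epowr (ennreal (\<nu> x)) (- conj_exp p / p)) (cube y l)) (1 / conj_exp p)
           \<le> ennreal C"
  shows "frac_avg (real CARD('n) - \<gamma>) f y l \<le> ennreal (C * W y l powr - (1 / q))
    * Lp_norm p \<nu> (restrict_to (cube y l) f)"
proof -
  note [measurable] = f weight_measurable[OF \<nu>] weight_measurable[OF weight]
  define n where "n = real CARD('n)"
  have n: "0 < n" by (simp add: n_def)
  define N where "N = l powr n"
  have N: "0 < N" "emeasure lebesgue (cube y l) = ennreal N"
    using l emeasure_cube[OF l, of y] by (simp_all add: N_def n_def)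
  define p' where "p' = conj_exp p"
  have p': "1 < p'" "1 / p + 1 / p' = 1" using p by (auto simp: p'_def conj_exp_def field_simps)
  define \<Sigma> where "\<Sigma> = (\<integral>\<^sup>+x\<in>cube y l. epowr (ennreal (\<nu> x)) (- p' / p) \<partial>lebesgue)"
  define e where "e = \<gamma> / n + 1 / q - 1 / p"
  have Wp: "0 < W y l" using l by (rule W_pos)
  \<comment> \<open>By the power mean inequality the bump dominates the plain average of \<open>w\<close>.\<close>
  have "epowr (cube_avg (\<lambda>x. ennreal (w x)) (cube y l)) (1 / q)
      \<le> epowr (epowr (cube_avg (\<lambda>x. epowr (ennreal (w x)) r) (cube y l)) (1 / r)) (1 / q)"
    using l r q by (intro epowr_mono cube_avg_power_mean) auto
  also have "\<dots> = epowr (cube_avg (\<lambda>x. epowr (ennreal (w x)) r) (cube y l)) (1 / (r * q))"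
    using r q by (simp add: epowr_epowr)
  finally have w_le: "epowr (cube_avg (\<lambda>x. ennreal (w x)) (cube y l)) (1 / q)
      \<le> epowr (cube_avg (\<lambda>x. epowr (ennreal (w x)) r) (cube y l)) (1 / (r * q))" .
  have "cube_avg (\<lambda>x. ennreal (w x)) (cube y l) = ennreal (W y l / N)"
    using N Wp by (simp add: cube_avg_def wmeas_def[symmetric] wmeas_eq_W divide_ennreal)
  then have w_eq: "epowr (cube_avg (\<lambda>x. ennreal (w x)) (cube y l)) (1 / q) = ennreal ((W y l / N) powr (1 / q))"
    using N Wp by (simp add: epowr_ennreal)
  have "epowr (ennreal N) e * epowr (cube_avg (\<lambda>x. ennreal (w x)) (cube y l)) (1 / q) * epowr (\<Sigma> / ennreal N) (1 / p')
      \<le> epowr (ennreal N) e * epowr (cube_avg (\<lambda>x. epowr (ennreal (w x)) r) (cube y l)) (1 / (r * q)) * epowr (\<Sigma> / ennreal N) (1 / p')"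
    by (intro mult_right_mono mult_left_mono w_le) auto
  also have "\<dots> \<le> ennreal C"
    using bump by (simp add: N cube_avg_def \<Sigma>_def p'_def e_def n_def)
  finally have 1: "ennreal (N powr e * (W y l / N) powr (1 / q)) * epowr (\<Sigma> / ennreal N) (1 / p') \<le> ennreal C"
    using N by (simp add: w_eq epowr_ennreal ennreal_mult)
  have pos: "0 < N powr e * (W y l / N) powr (1 / q)" using N Wp by simp
  have "\<Sigma> \<noteq> \<infinity>"
  proof
    assume "\<Sigma> = \<infinity>"
    then have "epowr (\<Sigma> / ennreal N) (1 / p') = \<infinity>"
      using N p' epowr_top[of "1 / p'"] by (simp add: ennreal_top_divide)
    then show False using 1 N Wp by (simp add: ennreal_mult_top top_unique)
  qed
  then obtain \<sigma> where \<sigma>: "\<Sigma> = ennreal \<sigma>" "0 \<le> \<sigma>" by (cases \<Sigma>) auto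
  have "N powr e * (W y l / N) powr (1 / q) * (\<sigma> / N) powr (1 / p') \<le> C"
    using 1 pos C N \<sigma> p' by (simp add: divide_ennreal epowr_ennreal_nonneg flip: ennreal_mult)
  moreover have "N powr e * (W y l / N) powr (1 / q) * (\<sigma> / N) powr (1 / p')
      = N powr (\<gamma> / n - 1) * W y l powr (1 / q) * \<sigma> powr (1 / p')"
  proof -
    have "\<gamma> / n - 1 = e - 1 / q - 1 / p'" using p' by (simp add: e_def)
    then show ?thesis
      using N Wp \<sigma> by (simp add: powr_divide powr_diff)
  qed
  moreover have "N powr (\<gamma> / n - 1) = l powr - (n - \<gamma>)"
    using l n by (simp add: N_def powr_powr right_diff_distrib)
  ultimately have "l powr - (n - \<gamma>) * W y l powr (1 / q) * \<sigma> powr (1 / p') \<le> C" by simp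
  then have 2: "l powr - (n - \<gamma>) * \<sigma> powr (1 / p') \<le> C * W y l powr - (1 / q)"
    using Wp by (simp add: powr_minus field_simps)
  \<comment> \<open>Hoelder's inequality; finiteness of the integral of the negative power excludes zeros of \<open>\<nu>\<close>.\<close>
  have ae: "AE x in lebesgue. epowr (ennreal (\<nu> x)) (- p' / p) * indicator (cube y l) x \<noteq> \<infinity>"
    using \<open>\<Sigma> \<noteq> \<infinity>\<close> unfolding \<Sigma>_def by (intro nn_integral_PInf_AE) auto
  let ?a = "\<lambda>x. epowr (ennreal (norm (f x) powr p * \<nu> x) * indicator (cube y l) x) (1 / p)"
  let ?b = "\<lambda>x. epowr (epowr (ennreal (\<nu> x)) (- p' / p) * indicator (cube y l) x) (1 / p')"
  have "(\<integral>\<^sup>+x\<in>cube y l. ennreal (norm (f x)) \<partial>lebesgue) \<le> (\<integral>\<^sup>+x. ?a x * ?b x \<partial>lebesgue)"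
    using ae
  proof (intro nn_integral_mono_AE, eventually_elim)
    fix x assume fin: "epowr (ennreal (\<nu> x)) (- p' / p) * indicator (cube y l) x \<noteq> \<infinity>"
    show "ennreal (norm (f x)) * indicator (cube y l) x \<le> ?a x * ?b x"
    proof (cases "x \<in> cube y l")
      case True
      have neg: "- p' / p < 0" using p p' by (simp add: field_simps)
      have "epowr 0 (- p' / p) = \<infinity>" using neg p p' by (simp add: epowr_def)
      then have "\<nu> x \<noteq> 0" using fin True by auto
      then have \<nu>x: "0 < \<nu> x" using \<nu> by (simp add: weight_def less_le)
      have "?a x = ennreal (norm (f x) * \<nu> x powr (1 / p))"
        using True \<nu>x p by (simp add: epowr_ennreal_nonneg powr_mult powr_powr)
      moreover have "?b x = ennreal (\<nu> x powr - (1 / p))"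
        using True \<nu>x p' by (simp add: epowr_ennreal powr_powr)
      moreover have "\<nu> x powr (1 / p) * \<nu> x powr - (1 / p) = 1"
        using \<nu>x by (simp flip: powr_add)
      ultimately have "?a x * ?b x = ennreal (norm (f x))"
        by (simp add: mult.assoc flip: ennreal_mult)
      then show ?thesis using True by simp
    qed simp
  qed
  also have "\<dots> \<le> epowr (\<integral>\<^sup>+x. epowr (?a x) p \<partial>lebesgue) (1 / p) * epowr (\<integral>\<^sup>+x. epowr (?b x) p' \<partial>lebesgue) (1 / p')"
    using p p' by (intro nn_integral_Holder) auto
  also have "\<dots> = Lp_norm p \<nu> (restrict_to (cube y l) f) * ennreal (\<sigma> powr (1 / p'))"
  proof -
    have "(\<integral>\<^sup>+x\<in>cube y l. epowr (ennreal (\<nu> x)) (- (p' / p)) \<partial>lebesgue) = ennreal \<sigma>"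
      using \<sigma> by (simp add: \<Sigma>_def)
    then show ?thesis
      using p p' \<sigma>(2) by (simp add: epowr_epowr epowr_one Lp_norm_restrict epowr_ennreal_nonneg)
  qed
  finally have "frac_avg (n - \<gamma>) f y l
      \<le> ennreal (l powr - (n - \<gamma>)) * (Lp_norm p \<nu> (restrict_to (cube y l) f) * ennreal (\<sigma> powr (1 / p')))"
    unfolding frac_avg_def by (intro mult_left_mono) auto
  also have "\<dots> = ennreal (l powr - (n - \<gamma>) * \<sigma> powr (1 / p')) * Lp_norm p \<nu> (restrict_to (cube y l) f)"
    by (simp add: ennreal_mult mult_ac)
  also have "\<dots> \<le> ennreal (C * W y l powr - (1 / q)) * Lp_norm p \<nu> (restrict_to (cube y l) f)"
    by (intro mult_right_mono ennreal_leI 2) simp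
  finally show ?thesis by (simp add: n_def)
qed

section \<open>Local integrability of the fractional integral\<close>

text \<open>Tonelli's theorem, with the symmetry of \<open>z \<in> Q(x, l)\<close> in \<open>x\<close> and \<open>z\<close>.\<close>

lemma nn_integral_cube_integral:
  fixes F :: "real ^ 'n \<Rightarrow> ennreal"
  assumes F: "F \<in> borel_measurable lebesgue" and l: "0 < l"
  shows "(\<integral>\<^sup>+x. (\<integral>\<^sup>+z\<in>cube x l. F z \<partial>lebesgue) \<partial>lebesgue)
    = ennreal (l powr real CARD('n)) * (\<integral>\<^sup>+z. F z \<partial>lebesgue)"
proof -
  obtain G where G[measurable]: "G \<in> borel_measurable borel" and eq: "AE x in lborel. F x = G x"
    using completion_ex_borel_measurable[OF F] by auto
  have inner: "(\<integral>\<^sup>+z\<in>cube x l. F z \<partial>lebesgue) = (\<integral>\<^sup>+z. G z * indicator (cube x l) z \<partial>lborel)" for x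
    unfolding nn_integral_lebesgue by (intro nn_integral_cong_AE) (use eq in \<open>eventually_elim, simp\<close>)
  have m: "(\<lambda>(x, z). G z * indicator (cube x l) z) \<in> borel_measurable (lborel \<Otimes>\<^sub>M lborel)"
  proof -
    have "(\<lambda>z. indicator (cube (fst z) l) (snd z) :: ennreal) \<in> borel_measurable (borel \<Otimes>\<^sub>M borel)"
      by (rule measurable_indicator_cube)
    then have "(\<lambda>z. G (snd z) * indicator (cube (fst z) l) (snd z)) \<in> borel_measurable (borel \<Otimes>\<^sub>M borel)"
      by measurable
    then show ?thesis
      by (simp add: case_prod_beta cong: measurable_cong_sets)
  qed
  have "(\<integral>\<^sup>+x. (\<integral>\<^sup>+z\<in>cube x l. F z \<partial>lebesgue) \<partial>lebesgue)
      = (\<integral>\<^sup>+x. (\<integral>\<^sup>+z. G z * indicator (cube x l) z \<partial>lborel) \<partial>lborel)"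
    by (simp add: inner nn_integral_lebesgue)
  also have "\<dots> = (\<integral>\<^sup>+z. (\<integral>\<^sup>+x. G z * indicator (cube x l) z \<partial>lborel) \<partial>lborel)"
    by (rule lborel_pair.Fubini'[OF m, symmetric])
  also have "\<dots> = (\<integral>\<^sup>+z. G z * ennreal (l powr real CARD('n)) \<partial>lborel)"
  proof (intro nn_integral_cong)
    fix z
    have "(\<integral>\<^sup>+x. G z * indicator (cube x l) z \<partial>lborel) = (\<integral>\<^sup>+x. G z * indicator (cube z l) x \<partial>lborel)"
      by (intro nn_integral_cong) (simp add: indicator_def mem_cube_commute)
    also have "\<dots> = G z * emeasure lborel (cube z l)"
      by (rule nn_integral_cmult_indicator) simp
    also have "emeasure lborel (cube z l) = ennreal (l powr real CARD('n))"
      using emeasure_cube[OF l, of z] by simp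
    finally show "(\<integral>\<^sup>+x. G z * indicator (cube x l) z \<partial>lborel) = G z * ennreal (l powr real CARD('n))" .
  qed
  also have "\<dots> = ennreal (l powr real CARD('n)) * (\<integral>\<^sup>+z. G z \<partial>lborel)"
    by (subst nn_integral_multc) (auto simp: mult.commute)
  also have "(\<integral>\<^sup>+z. G z \<partial>lborel) = (\<integral>\<^sup>+z. F z \<partial>lebesgue)"
    unfolding nn_integral_lebesgue by (intro nn_integral_cong_AE) (use eq in \<open>eventually_elim, simp\<close>)
  finally show ?thesis .
qed

text \<open>The integral over \<open>Q(y, l)\<close> of the fractional average at scale \<open>m \<le> l\<close> is at most \<open>m\<^sup>\<gamma>\<close> times the
  integral of \<open>\<bar>f\<bar>\<close> over \<open>Q(y, 2l)\<close>.\<close>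

lemma near_sum_AE_finite:
  fixes f :: "real ^ 'n \<Rightarrow> complex"
  assumes f: "locally_integrable f" and l: "0 < l" and \<gamma>: "0 < \<gamma>"
  shows "AE x in lebesgue. x \<in> cube y l \<longrightarrow> near_sum (real CARD('n) - \<gamma>) f x l < \<infinity>"
proof -
  define \<kappa> where "\<kappa> = real CARD('n) - \<gamma>"
  note fm[measurable] = locally_integrable_measurable[OF f]
  define I where "I = (\<integral>\<^sup>+z\<in>cube y (2 * l). ennreal (norm (f z)) \<partial>lebesgue)"
  have I: "I < \<infinity>" unfolding I_def by (rule locally_integrable_nn_integral_cube[OF f])
  have mf: "(\<lambda>z. ennreal (norm (f z))) \<in> borel_measurable lebesgue" by measurable
  have meas[measurable]: "(\<lambda>x. frac_avg \<kappa> f x m) \<in> borel_measurable lebesgue" for m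
  proof -
    have "(\<lambda>x. frac_avg \<kappa> f x m) \<in> borel_measurable borel"
      unfolding frac_avg_def using measurable_cube_integral[OF mf, of m] by measurable
    then show ?thesis by (intro measurable_completion) simp
  qed
  have piece: "(\<integral>\<^sup>+x\<in>cube y l. frac_avg \<kappa> f x m \<partial>lebesgue) \<le> ennreal (m powr \<gamma>) * I"
    if m: "0 < m" "m \<le> l" for m
  proof -
    let ?F = "\<lambda>z. ennreal (norm (f z)) * indicator (cube y (2 * l)) z"
    have "(\<integral>\<^sup>+x\<in>cube y l. frac_avg \<kappa> f x m \<partial>lebesgue)
        \<le> (\<integral>\<^sup>+x. ennreal (m powr - \<kappa>) * (\<integral>\<^sup>+z\<in>cube x m. ?F z \<partial>lebesgue) \<partial>lebesgue)"
    proof (intro nn_integral_mono)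
      fix x
      show "frac_avg \<kappa> f x m * indicator (cube y l) x
          \<le> ennreal (m powr - \<kappa>) * (\<integral>\<^sup>+z\<in>cube x m. ?F z \<partial>lebesgue)"
      proof (cases "x \<in> cube y l")
        case True
        have "cube x m \<subseteq> cube y (2 * l)" using m by (intro cube_subset[OF True]) simp
        then have "(\<integral>\<^sup>+z\<in>cube x m. ennreal (norm (f z)) \<partial>lebesgue) = (\<integral>\<^sup>+z\<in>cube x m. ?F z \<partial>lebesgue)"
          by (intro nn_integral_cong) (auto simp: indicator_def)
        then show ?thesis using True by (simp add: frac_avg_def)
      qed simp
    qed
    also have "\<dots> = ennreal (m powr - \<kappa>) * (\<integral>\<^sup>+x. (\<integral>\<^sup>+z\<in>cube x m. ?F z \<partial>lebesgue) \<partial>lebesgue)"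
    proof (rule nn_integral_cmult)
      have "(\<lambda>x. \<integral>\<^sup>+z\<in>cube x m. ?F z \<partial>lebesgue) \<in> borel_measurable borel"
        by (rule measurable_cube_integral) measurable
      then show "(\<lambda>x. \<integral>\<^sup>+z\<in>cube x m. ?F z \<partial>lebesgue) \<in> borel_measurable lebesgue"
        by (intro measurable_completion) simp
    qed
    also have "(\<integral>\<^sup>+x. (\<integral>\<^sup>+z\<in>cube x m. ?F z \<partial>lebesgue) \<partial>lebesgue)
        = ennreal (m powr real CARD('n)) * (\<integral>\<^sup>+z. ?F z \<partial>lebesgue)"
      using m by (intro nn_integral_cube_integral) measurable
    also have "ennreal (m powr - \<kappa>) * (ennreal (m powr real CARD('n)) * (\<integral>\<^sup>+z. ?F z \<partial>lebesgue))
        = ennreal (m powr \<gamma>) * I"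
    proof -
      have "m powr - \<kappa> * m powr real CARD('n) = m powr \<gamma>"
        by (simp add: \<kappa>_def flip: powr_add)
      then show ?thesis
        unfolding I_def mult.assoc[symmetric] by (simp flip: ennreal_mult)
    qed
    finally show ?thesis .
  qed
  define \<theta> where "\<theta> = 2 powr - \<gamma>"
  have \<theta>: "0 < \<theta>" "\<theta> < 1" using \<gamma> by (auto simp: \<theta>_def powr_less_one)
  have pow: "(l / 2 ^ j) powr \<gamma> = l powr \<gamma> * \<theta> ^ j" for j
  proof -
    have "\<theta> ^ j = 2 powr - (\<gamma> * real j)"
      unfolding \<theta>_def by (subst powr_realpow[symmetric]) (auto simp: powr_powr)
    moreover have "(2 ^ j) powr \<gamma> = 2 powr (\<gamma> * real j)"
      by (simp add: powr_powr mult.commute flip: powr_realpow)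
    ultimately show ?thesis
      using l by (simp add: powr_divide powr_minus field_simps)
  qed
  have "(\<integral>\<^sup>+x\<in>cube y l. near_sum \<kappa> f x l \<partial>lebesgue)
      = (\<integral>\<^sup>+x. (\<Sum>j. frac_avg \<kappa> f x (l / 2 ^ j) * indicator (cube y l) x) \<partial>lebesgue)"
    by (simp add: near_sum_def)
  also have "\<dots> = (\<Sum>j. (\<integral>\<^sup>+x\<in>cube y l. frac_avg \<kappa> f x (l / 2 ^ j) \<partial>lebesgue))"
    by (rule nn_integral_suminf) measurable
  also have "\<dots> \<le> (\<Sum>j. ennreal (l powr \<gamma> * \<theta> ^ j) * I)"
    using l by (intro suminf_le order_trans[OF piece]) (auto simp: pow divide_le_eq)
  also have "\<dots> = (\<Sum>j. ennreal (l powr \<gamma> * \<theta> ^ j)) * I" by (rule ennreal_suminf_multc)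
  also have "(\<Sum>j. ennreal (l powr \<gamma> * \<theta> ^ j)) = ennreal (l powr \<gamma> * (1 / (1 - \<theta>)))"
    using \<theta> by (intro suminf_ennreal_eq sums_mult geometric_sums) auto
  also have "\<dots> * I < \<infinity>" using I by (simp add: ennreal_mult_less_top)
  finally have "(\<integral>\<^sup>+x\<in>cube y l. near_sum \<kappa> f x l \<partial>lebesgue) \<noteq> \<infinity>" by simp
  moreover have "(\<lambda>x. near_sum \<kappa> f x l * indicator (cube y l) x) \<in> borel_measurable lebesgue"
    unfolding near_sum_def by measurable
  ultimately have "AE x in lebesgue. near_sum \<kappa> f x l * indicator (cube y l) x \<noteq> \<infinity>"
    by (intro nn_integral_PInf_AE)
  then show ?thesis
    by eventually_elim (auto simp: \<kappa>_def less_top)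
qed

section \<open>The pointwise estimate\<close>

lemma suminf_ennreal_le:
  fixes f :: "nat \<Rightarrow> ennreal"
  assumes "\<And>N. (\<Sum>i<N. f i) \<le> b"
  shows "(\<Sum>i. f i) \<le> b"
  unfolding suminf_eq_SUP by (rule SUP_least) (rule assms)

text \<open>A doubling weight \<open>w\<close> and a weight \<open>\<nu>\<close> for which fractional averages are controlled by
  local \<open>L\<^sup>p(\<nu>)\<close> norms, with the gain \<open>w(Q)\<close> to the power \<open>-1/q\<close>.\<close>

locale fractional_weights = doubling_weight w D
  for w :: "real ^ 'n \<Rightarrow> real" and D :: real +
  fixes \<nu> :: "real ^ 'n \<Rightarrow> real" and \<gamma> p q A :: real
  assumes \<nu>: "weight \<nu>"
    and \<gamma>_pos: "0 < \<gamma>" and \<gamma>_less: "\<gamma> < real CARD('n)"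
    and p: "1 < p" and pq: "p < q"
    and A: "0 < A"
    and frac_avg_le: "\<And>f y l. f \<in> borel_measurable lebesgue \<Longrightarrow> 0 < l \<Longrightarrow>
      frac_avg (real CARD('n) - \<gamma>) f y l
        \<le> ennreal (A * W y l powr - (1 / q)) * Lp_norm p \<nu> (restrict_to (cube y l) f)"
begin

text \<open>The order of the singularity of the kernel.\<close>

definition \<kappa> :: real where "\<kappa> = real CARD('n) - \<gamma>"

lemma \<kappa>_pos: "0 < \<kappa>"
  using \<gamma>_less by (simp add: \<kappa>_def)

text \<open>The gain in Hedberg's argument.\<close>

definition \<epsilon> :: real where "\<epsilon> = 1 / p - 1 / q"

lemma \<epsilon>_pos: "0 < \<epsilon>"
  using p pq by (simp add: \<epsilon>_def field_simps)

text \<open>The bound for the geometric sums in Hedberg's argument.\<close>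

definition H :: real where "H = 1 / (1 - rho powr \<epsilon>) + 1 / (1 - rho powr (1 / q))"

lemma H_pos: "0 < H"
  unfolding H_def using rho_bounds \<epsilon>_pos p pq
  by (intro add_pos_pos divide_pos_pos) (auto simp: powr01_less_one)

text \<open>Hedberg's argument: a bound \<open>\<tau>\<close> for the averages of \<open>F = \<bar>f\<bar>\<^sup>p \<nu>\<close> with respect to \<open>w\<close> and the
  total mass \<open>T\<close> of \<open>F\<close> bound each fractional average in two ways; the better of the two decays
  geometrically away from the scale at which \<open>w(Q) = T / \<tau>\<close>.\<close>

lemma near_sum_le_Hedberg:
  fixes f :: "real ^ 'n \<Rightarrow> complex"
  assumes f: "f \<in> borel_measurable lebesgue" and l: "0 < l" and x: "x \<in> cube y l"
    and T: "(\<integral>\<^sup>+z\<in>cube y (2 * l). ennreal (norm (f z) powr p * \<nu> z) \<partial>lebesgue) \<le> ennreal T" "0 < T"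
    and \<tau>: "0 < \<tau>"
      "\<And>j. (\<integral>\<^sup>+z\<in>cube x (l / 2 ^ j). ennreal (norm (f z) powr p * \<nu> z) \<partial>lebesgue)
              \<le> ennreal (\<tau> * W x (l / 2 ^ j))"
  shows "near_sum \<kappa> f x l \<le> ennreal (A * T powr \<epsilon> * \<tau> powr (1 / q) * H)"
proof -
  \<comment> \<open>Normalized so that the two bounds for the fractional average agree where \<open>u j = 1\<close>.\<close>
  define u where "u j = W x (l / 2 ^ j) * \<tau> / T" for j
  have lj: "0 < l / 2 ^ j" for j using l by simp
  have u_pos: "0 < u j" for j
    using W_pos[OF lj, of x j] \<tau> T by (simp add: u_def)
  have u_step: "u (Suc j) \<le> rho * u j" for j
  proof -
    have "W x (l / 2 ^ Suc j) \<le> rho * W x (l / 2 ^ j)"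
      using reverse_doubling[OF lj, of x "Suc j"] by simp
    then have "W x (l / 2 ^ Suc j) * (\<tau> / T) \<le> rho * W x (l / 2 ^ j) * (\<tau> / T)"
      using \<tau> T by (intro mult_right_mono) auto
    then show ?thesis by (simp add: u_def)
  qed
  have bound: "frac_avg \<kappa> f x (l / 2 ^ j)
      \<le> ennreal (A * T powr \<epsilon> * \<tau> powr (1 / q) * min (u j powr \<epsilon>) (u j powr - (1 / q)))" for j
  proof -
    define I where "I = (\<integral>\<^sup>+z\<in>cube x (l / 2 ^ j). ennreal (norm (f z) powr p * \<nu> z) \<partial>lebesgue)"
    have "l / 2 ^ j \<le> l" using l by (simp add: divide_le_eq)
    then have "cube x (l / 2 ^ j) \<subseteq> cube y (2 * l)"
      by (intro cube_subset[OF x]) simp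
    then have "I \<le> (\<integral>\<^sup>+z\<in>cube y (2 * l). ennreal (norm (f z) powr p * \<nu> z) \<partial>lebesgue)"
      unfolding I_def by (intro nn_integral_mono) (auto simp: indicator_def)
    then have "I \<le> ennreal T" using T by (blast intro: order_trans)
    moreover have "I \<le> ennreal (T * u j)"
      using \<tau>(2)[of j] T by (simp add: I_def u_def mult.commute)
    ultimately have "I \<le> ennreal (T * min 1 (u j))" by (simp add: min_def)
    then have "epowr I (1 / p) \<le> epowr (ennreal (T * min 1 (u j))) (1 / p)"
      using p by (intro epowr_mono) auto
    also have "\<dots> = ennreal (T powr (1 / p) * min 1 (u j) powr (1 / p))"
      using T u_pos[of j] by (simp add: epowr_ennreal powr_mult)
    finally have I: "epowr I (1 / p) \<le> ennreal (T powr (1 / p) * min 1 (u j) powr (1 / p))" .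
    have "frac_avg \<kappa> f x (l / 2 ^ j) \<le> ennreal (A * W x (l / 2 ^ j) powr - (1 / q)) * epowr I (1 / p)"
      using frac_avg_le[OF f lj, of x j] p by (simp add: \<kappa>_def Lp_norm_restrict I_def)
    also have "\<dots> \<le> ennreal (A * W x (l / 2 ^ j) powr - (1 / q)) * ennreal (T powr (1 / p) * min 1 (u j) powr (1 / p))"
      by (intro mult_left_mono I) simp
    also have "\<dots> = ennreal (A * W x (l / 2 ^ j) powr - (1 / q) * (T powr (1 / p) * min 1 (u j) powr (1 / p)))"
      using A by (simp flip: ennreal_mult)
    also have "A * W x (l / 2 ^ j) powr - (1 / q) * (T powr (1 / p) * min 1 (u j) powr (1 / p))
        = A * T powr \<epsilon> * \<tau> powr (1 / q) * (u j powr - (1 / q) * min 1 (u j) powr (1 / p))"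
    proof -
      have "W x (l / 2 ^ j) = u j * T / \<tau>" using \<tau> T by (simp add: u_def)
      then have "W x (l / 2 ^ j) powr - (1 / q) = u j powr - (1 / q) * T powr - (1 / q) * \<tau> powr (1 / q)"
        using u_pos[of j] T(2) \<tau>(1)
        by (simp only:, simp add: powr_mult powr_divide powr_minus, simp add: field_simps)
      moreover have "T powr \<epsilon> = T powr (1 / p) * T powr - (1 / q)"
        by (simp add: \<epsilon>_def flip: powr_add)
      ultimately show ?thesis by (simp add: mult_ac)
    qed
    also have "u j powr - (1 / q) * min 1 (u j) powr (1 / p) = min (u j powr \<epsilon>) (u j powr - (1 / q))"
    proof (cases "u j \<le> 1")
      case True
      have "u j powr \<epsilon> \<le> u j powr - (1 / q)"
        using True u_pos[of j] p pq \<epsilon>_pos by (intro powr_mono') (auto intro: order_trans[of _ 0])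
      then show ?thesis using True by (simp add: min_def \<epsilon>_def add.commute flip: powr_add)
    next
      case False
      have "u j powr - (1 / q) \<le> u j powr \<epsilon>"
        using False p pq \<epsilon>_pos by (intro powr_mono) (auto intro: order_trans[of _ 0])
      then show ?thesis using False by (simp add: min_def)
    qed
    finally show ?thesis .
  qed
  show ?thesis
    unfolding near_sum_def
  proof (rule suminf_ennreal_le)
    fix N
    define M where "M = A * T powr \<epsilon> * \<tau> powr (1 / q)"
    have M: "0 < M" using A T \<tau> by (simp add: M_def)
    have "(\<Sum>j<N. frac_avg \<kappa> f x (l / 2 ^ j)) \<le> (\<Sum>j<N. ennreal (M * min (u j powr \<epsilon>) (u j powr - (1 / q))))"
      unfolding M_def by (intro sum_mono bound)
    also have "\<dots> = ennreal (M * (\<Sum>j<N. min (u j powr \<epsilon>) (u j powr - (1 / q))))"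
      using M by (simp add: sum_distrib_left)
    also have "\<dots> \<le> ennreal (M * H)"
      unfolding H_def using M rho_bounds \<epsilon>_pos p pq
      by (intro ennreal_leI mult_left_mono sum_min_powr_le u_pos u_step) auto
    finally show "(\<Sum>j<N. frac_avg \<kappa> f x (l / 2 ^ j)) \<le> ennreal (A * T powr \<epsilon> * \<tau> powr (1 / q) * H)"
      by (simp add: M_def)
  qed
qed

text \<open>The constant of the weak type inequality for the small cubes.\<close>

definition K\<^sub>1 :: real where "K\<^sub>1 = D powr (3 / q) * A * H"

lemma K1_pos: "0 < K\<^sub>1"
  using A H_pos D_ge_1 by (simp add: K\<^sub>1_def)

text \<open>The weak type \<open>(p, q)\<close> inequality for the part of the fractional integral that involves
  small cubes.\<close>

lemma near_sum_weak_type: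
  fixes f :: "real ^ 'n \<Rightarrow> complex"
  assumes f[measurable]: "f \<in> borel_measurable lebesgue" and l: "0 < l" and t: "0 < t"
  shows "ennreal t * epowr (wmeas w {x \<in> cube y l. near_sum \<kappa> f x l > ennreal t}) (1 / q)
    \<le> ennreal K\<^sub>1 * Lp_norm p \<nu> (restrict_to (cube y (2 * l)) f)"
proof -
  note [measurable] = weight_measurable[OF \<nu>]
  let ?F = "\<lambda>z. ennreal (norm (f z) powr p * \<nu> z)"
  let ?S = "{x \<in> cube y l. near_sum \<kappa> f x l > ennreal t}"
  define I where "I = (\<integral>\<^sup>+z\<in>cube y (2 * l). ?F z \<partial>lebesgue)"
  have q: "0 < q" using p pq by simp
  have lj: "0 < l / 2 ^ j" for j using l by simp
  have sub: "cube x (l / 2 ^ j) \<subseteq> cube y (2 * l)" if "x \<in> cube y l" for x and j :: nat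
  proof -
    have "l / 2 ^ j \<le> l" using l by (simp add: divide_le_eq)
    then show ?thesis by (intro cube_subset[OF that]) simp
  qed
  have N: "Lp_norm p \<nu> (restrict_to (cube y (2 * l)) f) = epowr I (1 / p)"
    using p by (simp add: Lp_norm_restrict I_def)
  consider "I = \<infinity>" | "I = 0" | T where "I = ennreal T" "0 < T"
    by (cases I) (auto simp: less_le)
  then show ?thesis
  proof cases
    case 1
    then show ?thesis using N p K1_pos epowr_top[of "1 / p"] by (simp add: ennreal_mult_top)
  next
    case 2
    have "near_sum \<kappa> f x l = 0" if x: "x \<in> cube y l" for x
    proof -
      have "frac_avg \<kappa> f x (l / 2 ^ j) = 0" for j
      proof -
        have "(\<integral>\<^sup>+z\<in>cube x (l / 2 ^ j). ?F z \<partial>lebesgue) \<le> I"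
          unfolding I_def using sub[OF x, of j] by (intro nn_integral_mono) (auto simp: indicator_def)
        then have "Lp_norm p \<nu> (restrict_to (cube x (l / 2 ^ j)) f) = 0"
          using 2 p by (simp add: Lp_norm_restrict epowr_0)
        then show ?thesis using frac_avg_le[OF f lj, of x j] by (simp add: \<kappa>_def)
      qed
      then show ?thesis by (simp add: near_sum_def)
    qed
    then have "?S = {}" by auto
    then have "wmeas w ?S = 0" by (simp add: wmeas_def)
    then have "epowr (wmeas w ?S) (1 / q) = 0" using q by (simp only: epowr_0 zero_less_divide_1_iff)
    then show ?thesis by simp
  next
    case (3 T)
    define a where "a = A * T powr \<epsilon> * H"
    have a: "0 < a" using A H_pos 3 by (simp add: a_def)
    \<comment> \<open>The threshold for which Hedberg's bound equals \<open>t\<close>.\<close>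
    define \<tau> where "\<tau> = (t / a) powr q"
    have \<tau>: "0 < \<tau>" "\<tau> powr (1 / q) = t / a" using t a q by (auto simp: \<tau>_def powr_powr)
    have "ennreal \<tau> * wmeas w ?S \<le> ennreal (D ^ 3) * (\<integral>\<^sup>+z. ?F z * indicator (cube y (2 * l)) z \<partial>lebesgue)"
    proof (rule weak_type_maximal[where B = l])
      show "(\<lambda>z. ?F z * indicator (cube y (2 * l)) z) \<in> borel_measurable lebesgue" by measurable
      fix x assume "x \<in> ?S"
      then have x: "x \<in> cube y l" and big: "ennreal t < near_sum \<kappa> f x l" by auto
      have "\<exists>j. \<not> (\<integral>\<^sup>+z\<in>cube x (l / 2 ^ j). ?F z \<partial>lebesgue) \<le> ennreal (\<tau> * W x (l / 2 ^ j))"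
      proof (rule ccontr)
        assume "\<not> ?thesis"
        then have "near_sum \<kappa> f x l \<le> ennreal (A * T powr \<epsilon> * \<tau> powr (1 / q) * H)"
          using 3 \<tau> by (intro near_sum_le_Hedberg[OF f l x]) (auto simp: I_def)
        also have "A * T powr \<epsilon> * \<tau> powr (1 / q) * H = a * (t / a)"
          by (simp add: a_def \<tau>(2))
        also have "\<dots> = t" using a by simp
        finally show False using big by simp
      qed
      then obtain j where j: "ennreal (\<tau> * W x (l / 2 ^ j)) \<le> (\<integral>\<^sup>+z\<in>cube x (l / 2 ^ j). ?F z \<partial>lebesgue)"
        by (meson linear)
      have "(\<integral>\<^sup>+z\<in>cube x (l / 2 ^ j). ?F z \<partial>lebesgue)
          = (\<integral>\<^sup>+z\<in>cube x (l / 2 ^ j). (?F z * indicator (cube y (2 * l)) z) \<partial>lebesgue)"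
        using sub[OF x, of j] by (intro nn_integral_cong) (auto simp: indicator_def)
      then have "ennreal \<tau> * wmeas w (cube x (l / 2 ^ j))
          \<le> (\<integral>\<^sup>+z\<in>cube x (l / 2 ^ j). (?F z * indicator (cube y (2 * l)) z) \<partial>lebesgue)"
        using j \<tau> W_nonneg[of x] by (simp add: wmeas_eq_W ennreal_mult)
      moreover have "l / 2 ^ j \<le> l" using l by (simp add: divide_le_eq)
      ultimately show "\<exists>m. 0 < m \<and> m \<le> l \<and> ennreal \<tau> * wmeas w (cube x m)
          \<le> (\<integral>\<^sup>+z\<in>cube x m. (?F z * indicator (cube y (2 * l)) z) \<partial>lebesgue)"
        using lj[of j] by blast
    qed
    also have "\<dots> = ennreal (D ^ 3 * T)"
      using 3 D_ge_1 by (simp add: I_def[symmetric] ennreal_mult)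
    finally have "epowr (ennreal \<tau> * wmeas w ?S) (1 / q) \<le> epowr (ennreal (D ^ 3 * T)) (1 / q)"
      using q by (intro epowr_mono) auto
    then have "ennreal (t / a) * epowr (wmeas w ?S) (1 / q) \<le> ennreal ((D ^ 3 * T) powr (1 / q))"
      using q \<tau> 3 D_ge_1 by (simp add: epowr_mult epowr_ennreal)
    then have "ennreal a * (ennreal (t / a) * epowr (wmeas w ?S) (1 / q)) \<le> ennreal a * ennreal ((D ^ 3 * T) powr (1 / q))"
      by (intro mult_left_mono) auto
    also have "ennreal a * (ennreal (t / a) * epowr (wmeas w ?S) (1 / q)) = ennreal t * epowr (wmeas w ?S) (1 / q)"
      using a t by (simp flip: mult.assoc ennreal_mult)
    also have "ennreal a * ennreal ((D ^ 3 * T) powr (1 / q)) = ennreal (K\<^sub>1 * T powr (1 / p))"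
    proof -
      have "(D ^ 3) powr (1 / q) = D powr (3 / q)"
        using D_ge_1 by (simp add: powr_powr flip: powr_numeral)
      moreover have "T powr (1 / p) = T powr \<epsilon> * T powr (1 / q)"
        by (simp add: \<epsilon>_def flip: powr_add)
      ultimately have "a * (D ^ 3 * T) powr (1 / q) = K\<^sub>1 * T powr (1 / p)"
        using 3 D_ge_1 by (simp add: a_def K\<^sub>1_def powr_mult)
      then show ?thesis using a by (simp flip: ennreal_mult)
    qed
    also have "\<dots> = ennreal K\<^sub>1 * epowr I (1 / p)"
      using 3 K1_pos by (simp add: epowr_ennreal ennreal_mult)
    finally show ?thesis using N by simp
  qed
qed

text \<open>A bound for the part of the fractional integral that involves large cubes, uniform over
  the cube \<open>Q(y, l)\<close>.\<close>

definition far_bound :: "(real ^ 'n \<Rightarrow> complex) \<Rightarrow> real ^ 'n \<Rightarrow> real \<Rightarrow> ennreal" where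
  "far_bound f y l = ennreal (2 powr \<kappa>) * (\<Sum>j. frac_avg \<kappa> f y (l * 2 ^ (j + 2)))"

lemma far_sum_le:
  assumes l: "0 < l" and x: "x \<in> cube y l"
  shows "far_sum \<kappa> f x l \<le> far_bound f y l"
proof -
  have "frac_avg \<kappa> f x (l * 2 ^ Suc j) \<le> ennreal (2 powr \<kappa>) * frac_avg \<kappa> f y (l * 2 ^ (j + 2))" for j
  proof -
    have "l * 1 \<le> l * 2 ^ Suc j" using l by (intro mult_left_mono one_le_power) auto
    then have "cube x (l * 2 ^ Suc j) \<subseteq> cube y (l * 2 ^ (j + 2))"
      by (intro cube_subset[OF x]) simp
    then have "(\<integral>\<^sup>+z\<in>cube x (l * 2 ^ Suc j). ennreal (norm (f z)) \<partial>lebesgue)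
        \<le> (\<integral>\<^sup>+z\<in>cube y (l * 2 ^ (j + 2)). ennreal (norm (f z)) \<partial>lebesgue)"
      by (intro nn_integral_mono) (auto simp: indicator_def)
    then have "frac_avg \<kappa> f x (l * 2 ^ Suc j)
        \<le> ennreal ((l * 2 ^ Suc j) powr - \<kappa>) * (\<integral>\<^sup>+z\<in>cube y (l * 2 ^ (j + 2)). ennreal (norm (f z)) \<partial>lebesgue)"
      unfolding frac_avg_def by (intro mult_left_mono) auto
    also have "(l * 2 ^ Suc j) powr - \<kappa> = 2 powr \<kappa> * (l * 2 ^ (j + 2)) powr - \<kappa>"
    proof -
      have "(l * 2 ^ (j + 2)) powr - \<kappa> = (2 * (l * 2 ^ Suc j)) powr - \<kappa>" by (simp add: mult_ac)
      also have "\<dots> = 2 powr - \<kappa> * (l * 2 ^ Suc j) powr - \<kappa>" using l by (intro powr_mult)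
      finally show ?thesis by (simp add: powr_minus)
    qed
    finally show ?thesis by (simp add: frac_avg_def ennreal_mult mult.assoc)
  qed
  then show ?thesis
    unfolding far_sum_def far_bound_def ennreal_suminf_cmult[symmetric]
    by (intro suminf_le) auto
qed

text \<open>The constant in the majorization of the fractional integral by dyadic sums.\<close>

definition Z :: real where "Z = 4 powr \<kappa> / zeta_const CARD('n) \<gamma>"

lemma Z_pos: "0 < Z"
  using \<gamma>_pos \<gamma>_less by (simp add: Z_def zeta_const_def Gamma_real_pos)

lemma norm_frac_integral_le_sums:
  assumes f: "f \<in> borel_measurable lebesgue" and l: "0 < l" and x: "x \<in> cube y l"
  shows "ennreal (norm (frac_integral \<gamma> f x)) \<le> ennreal Z * (near_sum \<kappa> f x l + far_bound f y l)"
proof -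
  have \<zeta>: "0 < zeta_const CARD('n) \<gamma>"
    using \<gamma>_pos \<gamma>_less by (simp add: zeta_const_def Gamma_real_pos)
  have "ennreal (norm (frac_integral \<gamma> f x)) \<le> ennreal (1 / zeta_const CARD('n) \<gamma>) *
      (\<integral>\<^sup>+y. ennreal (norm (riesz_integrand \<gamma> f x y)) \<partial>lebesgue)"
    by (rule norm_frac_integral_le[OF \<gamma>_pos \<gamma>_less])
  also have "\<dots> \<le> ennreal (1 / zeta_const CARD('n) \<gamma>) *
      (ennreal (4 powr \<kappa>) * (near_sum \<kappa> f x l + far_sum \<kappa> f x l))"
    unfolding \<kappa>_def by (intro mult_left_mono nn_integral_riesz_le f l \<gamma>_less) simp
  also have "\<dots> = ennreal Z * (near_sum \<kappa> f x l + far_sum \<kappa> f x l)"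
    using \<zeta> by (simp add: Z_def flip: mult.assoc ennreal_mult)
  also have "\<dots> \<le> ennreal Z * (near_sum \<kappa> f x l + far_bound f y l)"
    by (intro mult_left_mono add_left_mono far_sum_le l x) simp
  finally show ?thesis .
qed

lemma WLp_norm_frac_integral_le:
  fixes f :: "real ^ 'n \<Rightarrow> complex"
  assumes f: "f \<in> borel_measurable lebesgue" and l: "0 < l"
  shows "WLp_norm q w (restrict_to (cube y l) (frac_integral \<gamma> f))
    \<le> ennreal (2 * Z * K\<^sub>1) * Lp_norm p \<nu> (restrict_to (cube y (2 * l)) f)
      + ennreal (2 * Z * W y l powr (1 / q)) * far_bound f y l"
  unfolding WLp_norm_def
proof (rule SUP_least)
  fix t :: real assume "t \<in> {0<..}"
  then have t: "0 < t" by simp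
  have q: "0 < q" using p pq by simp
  define B where "B = far_bound f y l"
  let ?S = "{x. norm (restrict_to (cube y l) (frac_integral \<gamma> f) x) > t}"
  have S: "x \<in> cube y l" "norm (frac_integral \<gamma> f x) > t" if "x \<in> ?S" for x
    using that t by (cases "x \<in> cube y l"; simp add: restrict_to_def)+
  show "ennreal t * epowr (wmeas w ?S) (1 / q)
    \<le> ennreal (2 * Z * K\<^sub>1) * Lp_norm p \<nu> (restrict_to (cube y (2 * l)) f)
      + ennreal (2 * Z * W y l powr (1 / q)) * far_bound f y l"
  proof (cases "ennreal t \<le> ennreal (2 * Z) * B")
    case True
    have "wmeas w ?S \<le> ennreal (W y l)"
      unfolding wmeas_eq_W[symmetric] by (rule wmeas_mono) (use S in blast)
    then have "epowr (wmeas w ?S) (1 / q) \<le> epowr (ennreal (W y l)) (1 / q)"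
      using q by (intro epowr_mono) auto
    also have "\<dots> = ennreal (W y l powr (1 / q))"
      using W_pos[OF l, of y] by (rule epowr_ennreal)
    finally have "ennreal t * epowr (wmeas w ?S) (1 / q) \<le> (ennreal (2 * Z) * B) * ennreal (W y l powr (1 / q))"
      using True by (intro mult_mono) auto
    also have "\<dots> = ennreal (2 * Z * W y l powr (1 / q)) * far_bound f y l"
      using Z_pos by (simp add: B_def ennreal_mult mult_ac)
    finally show ?thesis by (simp add: add_increasing)
  next
    case False
    then have B: "ennreal (2 * Z) * B < ennreal t" by simp
    then have "B \<noteq> \<infinity>" using Z_pos by (auto simp: ennreal_mult_top)
    then obtain b where b: "B = ennreal b" "0 \<le> b" by (cases B) auto
    have Zb: "2 * Z * b < t"
      using B b Z_pos by (simp add: ennreal_less_iff flip: ennreal_mult)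
    have "?S \<subseteq> {x \<in> cube y l. near_sum \<kappa> f x l > ennreal (t / (2 * Z))}"
    proof
      fix x assume x: "x \<in> ?S"
      have le: "ennreal (norm (frac_integral \<gamma> f x)) \<le> ennreal Z * (near_sum \<kappa> f x l + B)"
        unfolding B_def by (rule norm_frac_integral_le_sums[OF f l S(1)[OF x]])
      have "ennreal (t / (2 * Z)) < near_sum \<kappa> f x l"
      proof (rule ccontr)
        assume "\<not> ?thesis"
        then have "near_sum \<kappa> f x l \<le> ennreal (t / (2 * Z))" by simp
        then have "ennreal Z * (near_sum \<kappa> f x l + B) \<le> ennreal Z * (ennreal (t / (2 * Z)) + ennreal b)"
          unfolding b(1) by (intro mult_left_mono add_right_mono) auto
        also have "\<dots> = ennreal (Z * (t / (2 * Z) + b))"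
          using Z_pos t b by (simp flip: ennreal_plus ennreal_mult)
        also have "\<dots> \<le> ennreal t"
          using Z_pos Zb by (intro ennreal_leI) (simp add: distrib_left)
        finally have "ennreal (norm (frac_integral \<gamma> f x)) \<le> ennreal t" using le by (rule order_trans[rotated])
        then show False using S(2)[OF x] t by simp
      qed
      then show "x \<in> {x \<in> cube y l. near_sum \<kappa> f x l > ennreal (t / (2 * Z))}"
        using S(1)[OF x] by simp
    qed
    then have "ennreal t * epowr (wmeas w ?S) (1 / q)
        \<le> ennreal t * epowr (wmeas w {x \<in> cube y l. near_sum \<kappa> f x l > ennreal (t / (2 * Z))}) (1 / q)"
      using q by (intro mult_left_mono epowr_mono wmeas_mono) auto
    also have "\<dots> = ennreal (2 * Z) * (ennreal (t / (2 * Z))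
        * epowr (wmeas w {x \<in> cube y l. near_sum \<kappa> f x l > ennreal (t / (2 * Z))}) (1 / q))"
      using Z_pos t by (simp flip: mult.assoc ennreal_mult)
    also have "\<dots> \<le> ennreal (2 * Z) * (ennreal K\<^sub>1 * Lp_norm p \<nu> (restrict_to (cube y (2 * l)) f))"
      using Z_pos t by (intro mult_left_mono near_sum_weak_type f l) auto
    also have "\<dots> = ennreal (2 * Z * K\<^sub>1) * Lp_norm p \<nu> (restrict_to (cube y (2 * l)) f)"
      using Z_pos K1_pos by (simp add: ennreal_mult mult.assoc)
    finally show ?thesis by (simp add: add_increasing2)
  qed
qed

text \<open>The function of \<open>y\<close> whose outer norm enters the amalgam norm; the exponent \<open>e\<close> of
  \<open>w(Q)\<close> is kept general.\<close>

definition amalgam_fun :: "real \<Rightarrow> (real ^ 'n \<Rightarrow> complex) \<Rightarrow> real \<Rightarrow> real ^ 'n \<Rightarrow> ennreal" where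
  "amalgam_fun e f l y = epowr (wmeas w (cube y l)) e * Lp_norm p \<nu> (restrict_to (cube y l) f)"

lemma amalgam_fun_eq:
  "0 < l \<Longrightarrow> amalgam_fun e f l y = ennreal (W y l powr e) * Lp_norm p \<nu> (restrict_to (cube y l) f)"
  using W_pos[of l y] by (simp add: amalgam_fun_def wmeas_eq_W epowr_ennreal)

text \<open>Reverse doubling turns the positive exponent \<open>\<eta> = e + 1/q\<close> of \<open>w(Q)\<close> into geometric decay.\<close>

lemma far_bound_le:
  fixes f :: "real ^ 'n \<Rightarrow> complex"
  assumes f: "f \<in> borel_measurable lebesgue" and l: "0 < l" and \<eta>: "0 < \<eta>" "\<eta> = e + 1 / q"
  shows "ennreal (W y l powr \<eta>) * far_bound f y l
    \<le> (\<Sum>j. ennreal (2 powr \<kappa> * A * (rho powr \<eta>) ^ Suc j) * amalgam_fun e f (l * 2 ^ Suc (Suc j)) y)"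
proof -
  have "ennreal (W y l powr \<eta>) * (ennreal (2 powr \<kappa>) * frac_avg \<kappa> f y (l * 2 ^ (j + 2)))
      \<le> ennreal (2 powr \<kappa> * A * (rho powr \<eta>) ^ Suc j) * amalgam_fun e f (l * 2 ^ Suc (Suc j)) y" for j
  proof -
    define m where "m = l * 2 ^ Suc (Suc j)"
    have m: "0 < m" using l by (simp add: m_def)
    have Wm: "0 < W y m" by (rule W_pos[OF m])
    define N where "N = Lp_norm p \<nu> (restrict_to (cube y m) f)"
    have "W y l \<le> rho ^ Suc j * W y m"
    proof -
      have "W y l \<le> rho ^ Suc (Suc j) * W y m"
        using reverse_doubling_pow2[OF l, of y "Suc (Suc j)"] by (simp add: m_def mult.commute)
      also have "\<dots> \<le> rho ^ Suc j * W y m"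
        using rho_bounds Wm by (intro mult_right_mono power_decreasing) auto
      finally show ?thesis .
    qed
    then have "W y l powr \<eta> \<le> (rho ^ Suc j * W y m) powr \<eta>"
      using W_pos[OF l, of y] \<eta> by (intro powr_mono2) auto
    also have "\<dots> = (rho powr \<eta>) ^ Suc j * W y m powr \<eta>"
    proof -
      have "(rho ^ k) powr \<eta> = (rho powr \<eta>) ^ k" for k
        using rho_bounds by (simp add: powr_powr mult.commute flip: powr_realpow)
      then show ?thesis using rho_bounds Wm by (simp add: powr_mult)
    qed
    finally have 1: "W y l powr \<eta> \<le> (rho powr \<eta>) ^ Suc j * W y m powr \<eta>" .
    have "ennreal (W y l powr \<eta>) * (ennreal (2 powr \<kappa>) * frac_avg \<kappa> f y m)
        \<le> ennreal ((rho powr \<eta>) ^ Suc j * W y m powr \<eta>)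
          * (ennreal (2 powr \<kappa>) * (ennreal (A * W y m powr - (1 / q)) * N))"
      using frac_avg_le[OF f m, of y]
      by (intro mult_mono ennreal_leI 1 mult_left_mono) (auto simp: \<kappa>_def N_def)
    also have "\<dots> = ennreal ((rho powr \<eta>) ^ Suc j * W y m powr \<eta> * (2 powr \<kappa> * (A * W y m powr - (1 / q)))) * N"
      using A by (simp add: ennreal_mult mult.assoc)
    also have "(rho powr \<eta>) ^ Suc j * W y m powr \<eta> * (2 powr \<kappa> * (A * W y m powr - (1 / q)))
        = 2 powr \<kappa> * A * (rho powr \<eta>) ^ Suc j * W y m powr e"
    proof -
      have "W y m powr e = W y m powr \<eta> * W y m powr - (1 / q)"
        by (simp add: \<eta>(2) flip: powr_add)
      then show ?thesis by (simp add: mult_ac)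
    qed
    also have "ennreal (2 powr \<kappa> * A * (rho powr \<eta>) ^ Suc j * W y m powr e) * N
        = ennreal (2 powr \<kappa> * A * (rho powr \<eta>) ^ Suc j) * amalgam_fun e f m y"
      using A by (simp add: amalgam_fun_eq[OF m] N_def ennreal_mult mult.assoc)
    finally show ?thesis by (simp add: m_def)
  qed
  then show ?thesis
    unfolding far_bound_def ennreal_suminf_cmult[symmetric] by (intro suminf_le) auto
qed

text \<open>The coefficient of the geometric series in the pointwise estimate.\<close>

definition K\<^sub>2 :: "real \<Rightarrow> real" where "K\<^sub>2 e = 2 * Z * K\<^sub>1 * D powr - e + 2 * Z * 2 powr \<kappa> * A"

lemma K2_pos: "0 < K\<^sub>2 e"
  unfolding K\<^sub>2_def using Z_pos K1_pos A D_ge_1 by (intro add_pos_pos mult_pos_pos) auto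

text \<open>The small cubes contribute the first term of the series, the large cubes the other ones.\<close>

lemma weak_norm_le_series:
  fixes f :: "real ^ 'n \<Rightarrow> complex"
  assumes f: "f \<in> borel_measurable lebesgue" and l: "0 < l"
    and \<eta>: "0 < \<eta>" "\<eta> = e + 1 / q" and e: "e \<le> 0"
  shows "epowr (wmeas w (cube y l)) e * WLp_norm q w (restrict_to (cube y l) (frac_integral \<gamma> f))
    \<le> (\<Sum>j. ennreal (K\<^sub>2 e * (rho powr \<eta>) ^ j) * amalgam_fun e f (l * 2 ^ Suc j) y)"
proof -
  have Wl: "0 < W y l" by (rule W_pos[OF l])
  define N where "N = Lp_norm p \<nu> (restrict_to (cube y (2 * l)) f)"
  define g where "g j = amalgam_fun e f (l * 2 ^ Suc j) y" for j
  have "epowr (wmeas w (cube y l)) e * WLp_norm q w (restrict_to (cube y l) (frac_integral \<gamma> f))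
      = ennreal (W y l powr e) * WLp_norm q w (restrict_to (cube y l) (frac_integral \<gamma> f))"
    using Wl by (simp add: wmeas_eq_W epowr_ennreal)
  also have "\<dots> \<le> ennreal (W y l powr e) * (ennreal (2 * Z * K\<^sub>1) * N
      + ennreal (2 * Z * W y l powr (1 / q)) * far_bound f y l)"
    unfolding N_def by (intro mult_left_mono WLp_norm_frac_integral_le f l) simp
  also have "\<dots> = ennreal (2 * Z * K\<^sub>1) * (ennreal (W y l powr e) * N)
      + ennreal (2 * Z) * (ennreal (W y l powr \<eta>) * far_bound f y l)"
  proof -
    have "W y l powr \<eta> = W y l powr e * W y l powr (1 / q)"
      by (simp add: \<eta>(2) flip: powr_add)
    then show ?thesis
      using Z_pos K1_pos by (simp add: distrib_left ennreal_mult mult_ac)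
  qed
  also have "\<dots> \<le> ennreal (K\<^sub>2 e) * g 0 + (\<Sum>j. ennreal (K\<^sub>2 e * (rho powr \<eta>) ^ Suc j) * g (Suc j))"
  proof (rule add_mono)
    \<comment> \<open>As \<open>e \<le> 0\<close>, doubling allows to pass from \<open>Q\<close> to the doubled cube.\<close>
    have "W y (2 * l) \<le> D * W y l"
      using W_doubling_pow2[OF l, of "2 * l" 1 y] by simp
    then have "(D * W y l) powr e \<le> W y (2 * l) powr e"
      using W_pos[of "2 * l" y] l e by (intro powr_mono2') auto
    then have "W y l powr e \<le> D powr - e * W y (2 * l) powr e"
      using D_ge_1 Wl by (simp add: powr_mult powr_minus field_simps)
    then have "ennreal (2 * Z * K\<^sub>1) * (ennreal (W y l powr e) * N)
        \<le> ennreal (2 * Z * K\<^sub>1) * (ennreal (D powr - e * W y (2 * l) powr e) * N)"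
      by (intro mult_left_mono mult_right_mono ennreal_leI) auto
    also have "\<dots> = ennreal (2 * Z * K\<^sub>1 * D powr - e) * g 0"
      using Z_pos K1_pos l by (simp add: g_def amalgam_fun_eq N_def ennreal_mult mult_ac)
    also have "\<dots> \<le> ennreal (K\<^sub>2 e) * g 0"
      using Z_pos A by (intro mult_right_mono ennreal_leI) (auto simp: K\<^sub>2_def)
    finally show "ennreal (2 * Z * K\<^sub>1) * (ennreal (W y l powr e) * N) \<le> ennreal (K\<^sub>2 e) * g 0" .
    have "ennreal (2 * Z) * (ennreal (W y l powr \<eta>) * far_bound f y l)
        \<le> ennreal (2 * Z) * (\<Sum>j. ennreal (2 powr \<kappa> * A * (rho powr \<eta>) ^ Suc j) * g (Suc j))"
      unfolding g_def by (intro mult_left_mono far_bound_le f l \<eta>) simp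
    also have "\<dots> = (\<Sum>j. ennreal (2 * Z) * (ennreal (2 powr \<kappa> * A * (rho powr \<eta>) ^ Suc j) * g (Suc j)))"
      by (rule ennreal_suminf_cmult[symmetric])
    also have "\<dots> \<le> (\<Sum>j. ennreal (K\<^sub>2 e * (rho powr \<eta>) ^ Suc j) * g (Suc j))"
    proof (intro suminf_le)
      fix j
      have "ennreal (2 * Z) * (ennreal (2 powr \<kappa> * A * (rho powr \<eta>) ^ Suc j) * g (Suc j))
          = ennreal (2 * Z * 2 powr \<kappa> * A * (rho powr \<eta>) ^ Suc j) * g (Suc j)"
        using Z_pos A by (simp add: ennreal_mult mult.assoc)
      also have "\<dots> \<le> ennreal (K\<^sub>2 e * (rho powr \<eta>) ^ Suc j) * g (Suc j)"
        using Z_pos K1_pos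
        by (intro mult_right_mono ennreal_leI) (auto simp: K\<^sub>2_def)
      finally show "ennreal (2 * Z) * (ennreal (2 powr \<kappa> * A * (rho powr \<eta>) ^ Suc j) * g (Suc j))
          \<le> ennreal (K\<^sub>2 e * (rho powr \<eta>) ^ Suc j) * g (Suc j)" .
    qed auto
    finally show "ennreal (2 * Z) * (ennreal (W y l powr \<eta>) * far_bound f y l)
        \<le> (\<Sum>j. ennreal (K\<^sub>2 e * (rho powr \<eta>) ^ Suc j) * g (Suc j))" .
  qed
  also have "\<dots> = (\<Sum>j. ennreal (K\<^sub>2 e * (rho powr \<eta>) ^ j) * g j)"
    using suminf_offset[of "\<lambda>j. ennreal (K\<^sub>2 e * (rho powr \<eta>) ^ j) * g j" 1] by simp
  finally show ?thesis by (simp add: g_def)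
qed

end

section \<open>Boundedness between amalgam spaces\<close>

lemma Ls_norm_zero:
  assumes "0 < s" shows "Ls_norm s \<mu> (\<lambda>_. 0) = 0"
proof (cases "s = \<infinity>")
  case True
  have "esssup (density lebesgue (\<lambda>y. ennreal (\<mu> y))) (\<lambda>_. 0 :: ennreal) \<le> 0"
    by (rule esssup_I) auto
  then show ?thesis using True by (simp add: Ls_norm_def)
next
  case False
  then have "0 < enn2real s" using assms by (cases s) auto
  then show ?thesis using False by (simp add: Ls_norm_def epowr_0)
qed

lemma weak_amalgam_norm_null_weight:
  fixes w :: "real ^ 'n \<Rightarrow> real"
  assumes "AE x in lebesgue. w x = 0" "0 < q" "0 < s"
  shows "weak_amalgam_norm q s \<beta> w \<mu> f = 0"
proof -
  have "wmeas w E = 0" for E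
  proof -
    have "wmeas w E = (\<integral>\<^sup>+(x :: real ^ 'n). 0 \<partial>lebesgue)"
      unfolding wmeas_def by (rule nn_integral_cong_AE) (use assms(1) in \<open>eventually_elim, simp\<close>)
    then show ?thesis by simp
  qed
  then have "WLp_norm q w g = 0" for g :: "real ^ 'n \<Rightarrow> complex"
    using assms(2) by (simp add: WLp_norm_def epowr_0)
  then show ?thesis
    using assms(3) by (simp add: weak_amalgam_norm_def Ls_norm_zero)
qed

lemma suminf_ennreal_geometric:
  assumes "0 \<le> M" "0 < \<theta>" "\<theta> < (1::real)"
  shows "(\<Sum>j. ennreal (M * \<theta> ^ j)) = ennreal (M / (1 - \<theta>))"
  using assms sums_mult[OF geometric_sums, of \<theta> M] by (intro suminf_ennreal_eq) auto

context fractional_weights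
begin

lemma measurable_amalgam_fun:
  fixes f :: "real ^ 'n \<Rightarrow> complex"
  assumes f: "f \<in> borel_measurable lebesgue"
  shows "amalgam_fun e f l \<in> borel_measurable lebesgue"
proof -
  have p0: "0 < p" using p by simp
  have "(\<lambda>y. epowr (wmeas w (cube y l)) e * Lp_norm p \<nu> (restrict_to (cube y l) f)) \<in> borel_measurable borel"
    using measurable_wmeas_cube[OF weight, of l] measurable_Lp_norm[OF f \<nu> p0, of l] by measurable
  then show ?thesis
    unfolding amalgam_fun_def[abs_def] by (intro measurable_completion) simp
qed

context
  fixes \<mu> :: "real ^ 'n \<Rightarrow> real" and s :: ennreal and \<alpha> e \<eta> :: real
  assumes \<mu>: "weight \<mu>" and s: "1 < s"
    and e: "e = 1 / \<alpha> - 1 / p - enn2real (1 / s)" "e \<le> 0"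
    and \<eta>: "\<eta> = e + 1 / q" "0 < \<eta>"
begin

lemma Ls_norm_amalgam_fun_le:
  "0 < l \<Longrightarrow> Ls_norm s \<mu> (amalgam_fun e f l) \<le> amalgam_norm p s \<alpha> \<nu> w \<mu> f"
  unfolding amalgam_norm_def amalgam_fun_def[abs_def] e(1) by (rule SUP_upper) simp

lemma rho_powr_bounds: "0 < rho powr \<eta>" "rho powr \<eta> < 1"
  using rho_bounds \<eta>(2) by (auto simp: powr01_less_one)

lemma weak_amalgam_norm_le:
  fixes f :: "real ^ 'n \<Rightarrow> complex"
  assumes f: "f \<in> borel_measurable lebesgue" and \<beta>: "e = 1 / \<beta> - 1 / q - enn2real (1 / s)"
  shows "weak_amalgam_norm q s \<beta> w \<mu> (frac_integral \<gamma> f)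
    \<le> ennreal (K\<^sub>2 e / (1 - rho powr \<eta>)) * amalgam_norm p s \<alpha> \<nu> w \<mu> f"
  unfolding weak_amalgam_norm_def \<beta>[symmetric]
proof (rule SUP_least)
  fix l :: real assume "l \<in> {0<..}"
  then have l: "0 < l" by simp
  have q0: "0 < q" using p pq by simp
  show "Ls_norm s \<mu> (\<lambda>y. epowr (wmeas w (cube y l)) e * WLp_norm q w (restrict_to (cube y l) (frac_integral \<gamma> f)))
      \<le> ennreal (K\<^sub>2 e / (1 - rho powr \<eta>)) * amalgam_norm p s \<alpha> \<nu> w \<mu> f"
  proof (rule Ls_norm_series_le[OF s \<mu>, where g = "\<lambda>j. amalgam_fun e f (l * 2 ^ Suc j)"
        and c = "\<lambda>j. ennreal (K\<^sub>2 e * (rho powr \<eta>) ^ j)"])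
    have "(\<lambda>y. epowr (wmeas w (cube y l)) e * WLp_norm q w (restrict_to (cube y l) (frac_integral \<gamma> f)))
        \<in> borel_measurable borel"
      using measurable_wmeas_cube[OF weight, of l]
        measurable_WLp_norm[OF measurable_frac_integral[OF f, of \<gamma>] weight q0, of l] by measurable
    then show "(\<lambda>y. epowr (wmeas w (cube y l)) e * WLp_norm q w (restrict_to (cube y l) (frac_integral \<gamma> f)))
        \<in> borel_measurable lebesgue"
      by (intro measurable_completion) simp
    show "amalgam_fun e f (l * 2 ^ Suc j) \<in> borel_measurable lebesgue" for j
      by (rule measurable_amalgam_fun[OF f])
    show "epowr (wmeas w (cube y l)) e * WLp_norm q w (restrict_to (cube y l) (frac_integral \<gamma> f))
        \<le> (\<Sum>j. ennreal (K\<^sub>2 e * (rho powr \<eta>) ^ j) * amalgam_fun e f (l * 2 ^ Suc j) y)" for y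
      by (rule weak_norm_le_series[OF f l \<eta>(2,1) e(2)])
    show "Ls_norm s \<mu> (amalgam_fun e f (l * 2 ^ Suc j)) \<le> amalgam_norm p s \<alpha> \<nu> w \<mu> f" for j
      using l by (intro Ls_norm_amalgam_fun_le) simp
    show "(\<Sum>j. ennreal (K\<^sub>2 e * (rho powr \<eta>) ^ j)) \<le> ennreal (K\<^sub>2 e / (1 - rho powr \<eta>))"
      using K2_pos[of e] rho_powr_bounds by (simp only: suminf_ennreal_geometric less_imp_le)
    show "0 < K\<^sub>2 e / (1 - rho powr \<eta>)"
      using K2_pos[of e] rho_powr_bounds by simp
  qed
qed

text \<open>Outside a \<open>\<mu>\<close>-null set of centres \<open>y\<close>, the large cubes contribute a finite amount.\<close>

lemma far_bound_AE_finite: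
  fixes f :: "real ^ 'n \<Rightarrow> complex"
  assumes f: "f \<in> borel_measurable lebesgue" and fin: "amalgam_norm p s \<alpha> \<nu> w \<mu> f < \<infinity>"
    and l: "0 < l"
  shows "AE y in lebesgue. 0 < \<mu> y \<longrightarrow> far_bound f y l < \<infinity>"
proof -
  define M where "M = 2 powr \<kappa> * A"
  have M: "0 < M" using A by (simp add: M_def)
  define g where "g j = amalgam_fun e f (l * 2 ^ Suc (Suc j))" for j
  define G where "G y = (\<Sum>j. ennreal (M * (rho powr \<eta>) ^ Suc j) * g j y)" for y
  have g[measurable]: "g j \<in> borel_measurable lebesgue" for j
    unfolding g_def by (rule measurable_amalgam_fun[OF f])
  have G: "G \<in> borel_measurable lebesgue"
    unfolding G_def[abs_def] by measurable
  have "Ls_norm s \<mu> G \<le> ennreal (M / (1 - rho powr \<eta>)) * amalgam_norm p s \<alpha> \<nu> w \<mu> f"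
  proof (rule Ls_norm_series_le[OF s \<mu> G g])
    show "G y \<le> (\<Sum>j. ennreal (M * (rho powr \<eta>) ^ Suc j) * g j y)" for y
      by (simp add: G_def)
    show "Ls_norm s \<mu> (g j) \<le> amalgam_norm p s \<alpha> \<nu> w \<mu> f" for j
      unfolding g_def using l by (intro Ls_norm_amalgam_fun_le) simp
    have "(\<Sum>j. ennreal (M * (rho powr \<eta>) ^ Suc j)) \<le> (\<Sum>j. ennreal (M * (rho powr \<eta>) ^ j))"
      using M rho_powr_bounds
      by (intro suminf_le ennreal_leI mult_left_mono power_decreasing) auto
    then show "(\<Sum>j. ennreal (M * (rho powr \<eta>) ^ Suc j)) \<le> ennreal (M / (1 - rho powr \<eta>))"
      using M rho_powr_bounds by (simp only: suminf_ennreal_geometric less_imp_le)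
    show "0 < M / (1 - rho powr \<eta>)"
      using M rho_powr_bounds by simp
  qed
  also have "\<dots> < \<infinity>" using fin by (simp add: ennreal_mult_less_top)
  finally have "AE y in lebesgue. 0 < \<mu> y \<longrightarrow> G y < \<infinity>"
    using s by (intro Ls_norm_finite_AE \<mu> G) (auto intro: less_trans[of 0 1])
  then show ?thesis
  proof eventually_elim
    case (elim y)
    have "ennreal (W y l powr \<eta>) * far_bound f y l \<le> G y"
      unfolding G_def g_def M_def by (rule far_bound_le[OF f l \<eta>(2,1)])
    moreover have "ennreal (W y l powr \<eta>) \<noteq> 0"
      using W_pos[OF l, of y] by simp
    ultimately have "far_bound f y l \<noteq> \<infinity>" if "G y < \<infinity>"
      using that by (auto simp: ennreal_mult_top top_unique)
    then show ?case
      using elim by (auto simp: less_top)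
  qed
qed

text \<open>One centre \<open>y\<close> with \<open>\<mu>(y) > 0\<close> at which the large cubes are under control for all scales \<open>2\<^sup>m\<close> suffices,
  as the cubes \<open>Q(y, 2\<^sup>m)\<close> exhaust the space.\<close>

lemma AE_integrable_riesz_integrand:
  fixes f :: "real ^ 'n \<Rightarrow> complex"
  assumes f: "locally_integrable f" and fin: "amalgam_norm p s \<alpha> \<nu> w \<mu> f < \<infinity>"
    and \<mu>0: "\<not> (AE y in lebesgue. \<mu> y = 0)"
  shows "AE x in lebesgue. integrable lebesgue (riesz_integrand \<gamma> f x)"
proof -
  note fm = locally_integrable_measurable[OF f]
  have ae: "AE y in lebesgue. \<forall>m::nat. 0 < \<mu> y \<longrightarrow> far_bound f y (2 ^ m) < \<infinity>"
    unfolding AE_all_countable by (intro allI far_bound_AE_finite fm fin) simp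
  have "\<exists>y. (\<forall>m::nat. 0 < \<mu> y \<longrightarrow> far_bound f y (2 ^ m) < \<infinity>) \<and> \<mu> y \<noteq> 0"
  proof (rule ccontr)
    assume no: "\<not> ?thesis"
    have "AE y in lebesgue. \<mu> y = 0"
      using ae by eventually_elim (use no in blast)
    with \<mu>0 show False by contradiction
  qed
  then obtain y where y: "\<And>m::nat. 0 < \<mu> y \<longrightarrow> far_bound f y (2 ^ m) < \<infinity>" "\<mu> y \<noteq> 0" by blast
  then have far: "far_bound f y (2 ^ m) < \<infinity>" for m :: nat
    using \<mu> by (simp add: weight_def less_le)
  have "AE x in lebesgue. \<forall>m::nat. x \<in> cube y (2 ^ m) \<longrightarrow> near_sum \<kappa> f x (2 ^ m) < \<infinity>"
    unfolding AE_all_countable \<kappa>_def by (intro allI near_sum_AE_finite f \<gamma>_pos) simp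
  then show ?thesis
  proof eventually_elim
    case (elim x)
    obtain m :: nat where m: "2 * dist y x < 2 ^ m"
      using real_arch_pow[of 2 "2 * dist y x"] by auto
    have "x \<in> cube y (2 * dist y x)"
      using cball_subset_cube[of y "dist y x"] by auto
    then have x: "x \<in> cube y (2 ^ m)"
      using cube_mono[of "2 * dist y x" "2 ^ m" y] m by auto
    have "far_sum \<kappa> f x (2 ^ m) < \<infinity>"
      using far_sum_le[OF _ x, of f] far[of m] by (simp add: le_less_trans)
    then have "ennreal (4 powr \<kappa>) * (near_sum \<kappa> f x (2 ^ m) + far_sum \<kappa> f x (2 ^ m)) < \<infinity>"
      using elim x by (simp add: ennreal_mult_less_top)
    moreover have "(\<integral>\<^sup>+z. ennreal (norm (riesz_integrand \<gamma> f x z)) \<partial>lebesgue)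
        \<le> ennreal (4 powr \<kappa>) * (near_sum \<kappa> f x (2 ^ m) + far_sum \<kappa> f x (2 ^ m))"
      unfolding \<kappa>_def by (intro nn_integral_riesz_le fm \<gamma>_less) simp
    ultimately have "(\<integral>\<^sup>+z. ennreal (norm (riesz_integrand \<gamma> f x z)) \<partial>lebesgue) < \<infinity>"
      by (rule le_less_trans[rotated])
    then show "integrable lebesgue (riesz_integrand \<gamma> f x)"
      by (intro integrableI_bounded measurable_riesz_integrand fm)
  qed
qed

end

end

theorem theorem2p2:
  fixes \<gamma> p q r \<alpha> \<beta> C :: real
    and s :: ennreal
    and w \<nu> \<mu> :: "real ^ 'n \<Rightarrow> real"
  assumes "0 < \<gamma>" and "\<gamma> < real CARD('n)"
    and "1 < p" and "p < q"
    and "\<mu> \<in> Delta2"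
    and "weight w" and "weight \<nu>"
    and "r > 1"
    and "\<And>(y :: real ^ 'n) l. l > 0 \<Longrightarrow>
           epowr (emeasure lebesgue (cube y l)) (\<gamma> / real CARD('n) + 1 / q - 1 / p)
           * epowr (cube_avg (\<lambda>x. epowr (ennreal (w x)) r) (cube y l)) (1 / (r * q))
           * epowr (cube_avg (\<lambda>x. epowr (ennreal (\<nu> x)) (- conj_exp p / p)) (cube y l)) (1 / conj_exp p)
           \<le> ennreal C"
    and "p \<le> \<alpha>" and "\<alpha> < \<beta>" and "ennreal \<beta> < s"
    and "w \<in> Delta2"
    and "1 / \<beta> = 1 / \<alpha> - (1 / p - 1 / q)"
  shows "bounded_operator (frac_integral \<gamma>)
           (amalgam_space p s \<alpha> \<nu> w \<mu>) (amalgam_norm p s \<alpha> \<nu> w \<mu>)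
           (weak_amalgam_space q s \<beta> w \<mu>) (weak_amalgam_norm q s \<beta> w \<mu>)
         \<and> (\<forall>f \<in> amalgam_space p s \<alpha> \<nu> w \<mu>.
              (AE x in lebesgue. w x = 0) \<or> (AE x in lebesgue. \<mu> x = 0) \<or>
              (AE x in lebesgue. integrable lebesgue (riesz_integrand \<gamma> f x)))"
proof (cases "AE x in lebesgue. w x = 0")
  case True
  have q: "0 < q" and s: "0 < s"
    using assms(3,4,12) by (auto intro: le_less_trans[OF zero_le])
  have 0: "weak_amalgam_norm q s \<beta> w \<mu> (frac_integral \<gamma> f) = 0" for f
    by (rule weak_amalgam_norm_null_weight[OF True q s])
  have "frac_integral \<gamma> f \<in> weak_amalgam_space q s \<beta> w \<mu>" if "f \<in> amalgam_space p s \<alpha> \<nu> w \<mu>" for f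
  proof -
    have "f \<in> borel_measurable lebesgue"
      using that by (simp add: amalgam_space_def locally_integrable_measurable)
    then show ?thesis
      by (simp add: weak_amalgam_space_def 0 measurable_frac_integral)
  qed
  then show ?thesis
    using True 0 by (simp add: bounded_operator_def)
next
  case False
  obtain D where D: "0 < D"
    "\<And>y l. 0 < l \<Longrightarrow> wmeas w (dilated_cube 2 y l) \<le> ennreal D * wmeas w (cube y l)"
    using assms(13) by (auto simp: Delta2_def)
  \<comment> \<open>The maxima with \<open>1\<close>, here and below, make the constants admissible in the two locales.\<close>
  interpret doubling_weight w "max D 1"
  proof
    show "wmeas w (dilated_cube 2 y l) \<le> ennreal (max D 1) * wmeas w (cube y l)" if "0 < l" for y l
    proof -
      have "ennreal D * wmeas w (cube y l) \<le> ennreal (max D 1) * wmeas w (cube y l)"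
        by (intro mult_right_mono ennreal_leI) auto
      then show ?thesis using D(2)[OF that, of y] by (rule order_trans[rotated])
    qed
  qed (use False assms in auto)
  have frac: "frac_avg (real CARD('n) - \<gamma>) f y l
      \<le> ennreal (max C 1 * W y l powr - (1 / q)) * Lp_norm p \<nu> (restrict_to (cube y l) f)"
    if "f \<in> borel_measurable lebesgue" "0 < l" for f y l
  proof (rule frac_avg_le_of_bump[OF assms(7) that assms(3) _ assms(8)])
    show "epowr (emeasure lebesgue (cube y l)) (\<gamma> / real CARD('n) + 1 / q - 1 / p)
         * epowr (cube_avg (\<lambda>x. epowr (ennreal (w x)) r) (cube y l)) (1 / (r * q))
         * epowr (cube_avg (\<lambda>x. epowr (ennreal (\<nu> x)) (- conj_exp p / p)) (cube y l)) (1 / conj_exp p)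
         \<le> ennreal (max C 1)"
      by (rule order_trans[OF assms(9)[OF that(2)]]) (simp add: ennreal_leI)
  qed (use assms(3,4) in auto)
  interpret fractional_weights w "max D 1" \<nu> \<gamma> p q "max C 1"
    by unfold_locales (use assms frac in auto)
  have \<beta>: "1 < \<beta>" "0 < \<alpha>" using assms(3,10,11) by auto
  have s: "1 < s"
  proof -
    have "1 < ennreal \<beta>" using \<beta> by simp
    then show ?thesis using assms(12) by (rule less_trans)
  qed
  have \<mu>: "weight \<mu>" using assms(5) by (simp add: Delta2_def)
  define e where "e = 1 / \<alpha> - 1 / p - enn2real (1 / s)"
  define \<eta> where "\<eta> = e + 1 / q"
  have e_\<beta>: "e = 1 / \<beta> - 1 / q - enn2real (1 / s)"
    using assms(14) by (simp add: e_def)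
  have "1 / \<alpha> \<le> 1 / p" using assms(3,10) by (intro divide_left_mono) auto
  moreover have "0 \<le> enn2real (1 / s)" by (rule enn2real_nonneg)
  ultimately have e: "e \<le> 0" unfolding e_def by linarith
  have "enn2real (1 / s) < 1 / \<beta>"
  proof (cases s)
    case (real \<sigma>)
    then have "\<beta> < \<sigma>" using assms(12) \<beta> by (simp add: ennreal_less_iff)
    then show ?thesis
      using real \<beta> by (simp add: divide_ennreal[of 1, simplified] frac_less2)
  next
    case top
    then show ?thesis using \<beta> by simp
  qed
  then have \<eta>: "0 < \<eta>" by (simp add: \<eta>_def e_\<beta>)
  note bound = weak_amalgam_norm_le[OF \<mu> s e_def e \<eta>_def \<eta> _ e_\<beta>]
  have "frac_integral \<gamma> f \<in> weak_amalgam_space q s \<beta> w \<mu>"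
    if "f \<in> amalgam_space p s \<alpha> \<nu> w \<mu>" for f
  proof -
    have f: "f \<in> borel_measurable lebesgue" "amalgam_norm p s \<alpha> \<nu> w \<mu> f < \<infinity>"
      using that by (auto simp: amalgam_space_def locally_integrable_measurable)
    then have "weak_amalgam_norm q s \<beta> w \<mu> (frac_integral \<gamma> f) < \<infinity>"
      using bound[OF f(1)] by (simp add: ennreal_mult_less_top le_less_trans)
    then show ?thesis
      using measurable_frac_integral[OF f(1)] by (simp add: weak_amalgam_space_def)
  qed
  moreover have "\<forall>f \<in> amalgam_space p s \<alpha> \<nu> w \<mu>. weak_amalgam_norm q s \<beta> w \<mu> (frac_integral \<gamma> f)
      \<le> ennreal (K\<^sub>2 e / (1 - rho powr \<eta>)) * amalgam_norm p s \<alpha> \<nu> w \<mu> f"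
    by (auto simp: amalgam_space_def intro!: bound locally_integrable_measurable)
  moreover have "AE x in lebesgue. integrable lebesgue (riesz_integrand \<gamma> f x)"
    if "f \<in> amalgam_space p s \<alpha> \<nu> w \<mu>" "\<not> (AE x in lebesgue. \<mu> x = 0)" for f
    using that by (intro AE_integrable_riesz_integrand[OF \<mu> s e_def e \<eta>_def \<eta>])
      (auto simp: amalgam_space_def)
  ultimately show ?thesis
    unfolding bounded_operator_def by blast
qed

end
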